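(* Let $X=(X_t)_{t\in\mathbb{R}_+}$ be a (càdlàg) Lévy process with characteristic triplet $(\gamma,\sigma,\nu)$ and let $\Omega_X=\{\omega\in\Omega:X(\omega)\in\mathcal S'(\mathbb{R})\}$. Then: (i) If there exists $\eta>0$ such that $\mathbb{E}(|X_1|^\eta)<+\infty$, then $\mathbb{P}(\Omega_X)=1$. (ii) If for all $\eta>0$, $\mathbb{E}(|X_1|^\eta)=+\infty$, then $\mathbb{P}(\Omega_X)=0$.
   Context: $(\Omega,\mathcal F,\mathbb P)$ is a complete probability space. A Lévy process is a real-valued process $(X_t)_{t\in\mathbb{R}_+}$ with $X_0=0$ a.s., stationary independent increments, stochastically continuous; a càdlàg modification is always taken. Its characteristic triplet $(\gamma,\sigma,\nu)$ ($\gamma\in\mathbb{R}$, $\sigma\ge0$, $\nu$ a Lévy measure) is taken with respect to the truncation function $\mathbf 1_{|x|\le1}$. $X(\omega)$ is viewed as an element of $\mathcal D'(\mathbb{R})$ via $\langle X(\omega),\varphi\rangle=\int_{\mathbb{R}_+}X_t(\omega)\varphi(t)\,dt$. $\mathcal S'(\mathbb{R})$ is the space of tempered distributions (continuous linear functionals on the Schwartz space $\mathcal S(\mathbb{R})$). In the definition of $\Omega_X$ it is understood that when $X(\omega)\in\mathcal S'(\mathbb{R})$, the associated continuous linear functional is $\langle X(\omega),\varphi\rangle=\int_{\mathbb{R}_+}X_t(\omega)\varphi(t)\,dt$ for all $\varphi\in\mathcal S(\mathbb{R})$. *)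

theory Defs
  imports "HOL-Probability.Probability"
begin

section \<open>Schwartz functions and tempered distributions on the real line\<close>

definition smooth_real :: "(real \<Rightarrow> real) \<Rightarrow> bool" where
  "smooth_real \<phi> \<longleftrightarrow> (\<forall>k x. (deriv ^^ k) \<phi> field_differentiable at x)"

definition schwartz_space :: "(real \<Rightarrow> real) set" where
  "schwartz_space = {\<phi>. smooth_real \<phi> \<and>
     (\<forall>a b. bounded (range (\<lambda>x. x ^ a * (deriv ^^ b) \<phi> x)))}"

definition schwartz_seminorm :: "nat \<Rightarrow> nat \<Rightarrow> (real \<Rightarrow> real) \<Rightarrow> real" where
  "schwartz_seminorm a b \<phi> = (SUP x. \<bar>x ^ a * (deriv ^^ b) \<phi> x\<bar>)"

text \<open>The locally convex topology of the family of seminorms, on the carrier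
  \<^const>\<open>schwartz_space\<close>: the seminorm balls are a subbasis.\<close>

definition schwartz_topology :: "(real \<Rightarrow> real) topology" where
  "schwartz_topology = topology_generated_by
     {{\<psi> \<in> schwartz_space. schwartz_seminorm a b (\<lambda>x. \<psi> x - \<phi> x) < e} | \<phi> a b e.
        \<phi> \<in> schwartz_space \<and> 0 < e}"

lemma topspace_schwartz_topology: "topspace schwartz_topology = schwartz_space"
proof -
  have zero: "(deriv ^^ k) (\<lambda>x. 0 :: real) = (\<lambda>x. 0)" for k
    by (induction k) simp_all
  have "\<phi> \<in> topspace schwartz_topology" if "\<phi> \<in> schwartz_space" for \<phi>
  proof -
    have "\<phi> \<in> {\<psi> \<in> schwartz_space. schwartz_seminorm 0 0 (\<lambda>x. \<psi> x - \<phi> x) < 1}"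
      using that by (simp add: schwartz_seminorm_def zero)
    then show ?thesis
      using that unfolding schwartz_topology_def topology_generated_by_topspace
      by (intro UnionI[where X = "{\<psi> \<in> schwartz_space. schwartz_seminorm 0 0 (\<lambda>x. \<psi> x - \<phi> x) < 1}"])
        (auto intro!: exI[of _ \<phi>] exI[of _ "0::nat"] exI[of _ "1::real"])
  qed
  then show ?thesis
    by (auto simp: schwartz_topology_def topology_generated_by_topspace)
qed

text \<open>Linearity is only required on \<^const>\<open>schwartz_space\<close>; the values of the functional
  elsewhere are irrelevant.\<close>

definition tempered_distribution :: "((real \<Rightarrow> real) \<Rightarrow> real) \<Rightarrow> bool" where
  "tempered_distribution T \<longleftrightarrow>
     (\<forall>\<phi>\<in>schwartz_space. \<forall>\<psi>\<in>schwartz_space. T (\<lambda>x. \<phi> x + \<psi> x) = T \<phi> + T \<psi>) \<and>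
     (\<forall>c. \<forall>\<phi>\<in>schwartz_space. T (\<lambda>x. c * \<phi> x) = c * T \<phi>) \<and>
     continuous_map schwartz_topology euclideanreal T"


section \<open>Levy processes\<close>

definition cadlag :: "(real \<Rightarrow> real) \<Rightarrow> bool" where
  "cadlag f \<longleftrightarrow> (\<forall>t\<ge>0. (f \<longlongrightarrow> f t) (at_right t)) \<and> (\<forall>t>0. \<exists>l. (f \<longlongrightarrow> l) (at_left t))"

text \<open>The time set is the half-line of nonnegative reals; \<open>X t\<close> is unconstrained for negative \<open>t\<close>.\<close>

locale levy_process = prob_space M for M :: "'w measure" +
  fixes X :: "real \<Rightarrow> 'w \<Rightarrow> real"
  assumes random_variable_X: "\<And>t. 0 \<le> t \<Longrightarrow> random_variable borel (X t)"
    and start_zero: "AE \<omega> in M. X 0 \<omega> = 0"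
    and independent_increments:
      "\<And>(n::nat) t. 0 \<le> t 0 \<Longrightarrow> (\<And>i. i < n \<Longrightarrow> t i < t (Suc i)) \<Longrightarrow>
         indep_vars (\<lambda>_. borel) (\<lambda>i \<omega>. X (t (Suc i)) \<omega> - X (t i) \<omega>) {..<n}"
    and stationary_increments:
      "\<And>s h. 0 \<le> s \<Longrightarrow> 0 \<le> h \<Longrightarrow>
         distr M borel (\<lambda>\<omega>. X (s + h) \<omega> - X s \<omega>) = distr M borel (\<lambda>\<omega>. X h \<omega> - X 0 \<omega>)"
    and stochastically_continuous:
      "\<And>t \<epsilon>. 0 \<le> t \<Longrightarrow> 0 < \<epsilon> \<Longrightarrow>
         ((\<lambda>s. prob {\<omega> \<in> space M. \<epsilon> < \<bar>X s \<omega> - X t \<omega>\<bar>}) \<longlongrightarrow> 0) (at t within {0..})"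

locale cadlag_levy_process = levy_process +
  assumes cadlag_paths: "AE \<omega> in M. cadlag (\<lambda>t. X t \<omega>)"

definition levy_measure :: "real measure \<Rightarrow> bool" where
  "levy_measure \<nu> \<longleftrightarrow> sets \<nu> = sets borel \<and> emeasure \<nu> {0} = 0 \<and>
     (\<integral>\<^sup>+ x. ennreal (min 1 (x\<^sup>2)) \<partial>\<nu>) < \<infinity>"

definition levy_exponent :: "real \<Rightarrow> real \<Rightarrow> real measure \<Rightarrow> real \<Rightarrow> complex" where
  "levy_exponent \<gamma> \<sigma> \<nu> u =
     \<i> * complex_of_real (\<gamma> * u) - complex_of_real (\<sigma>\<^sup>2 * u\<^sup>2 / 2) +
     (CLINT x|\<nu>. iexp (u * x) - 1 - \<i> * complex_of_real (u * x * indicator {x. \<bar>x\<bar> \<le> 1} x))"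

text \<open>The triplet is the one of the Levy-Khintchine formula; \<open>\<sigma>\<close> is the standard deviation
  (not the variance) of the Gaussian part at time 1.\<close>

definition characteristic_triplet ::
  "'w measure \<Rightarrow> (real \<Rightarrow> 'w \<Rightarrow> real) \<Rightarrow> real \<Rightarrow> real \<Rightarrow> real measure \<Rightarrow> bool" where
  "characteristic_triplet M X \<gamma> \<sigma> \<nu> \<longleftrightarrow> 0 \<le> \<sigma> \<and> levy_measure \<nu> \<and>
     (\<forall>t\<ge>0. \<forall>u. char (distr M borel (X t)) u = exp (complex_of_real t * levy_exponent \<gamma> \<sigma> \<nu> u))"


section \<open>Paths as tempered distributions\<close>

definition path_functional :: "(real \<Rightarrow> 'w \<Rightarrow> real) \<Rightarrow> 'w \<Rightarrow> (real \<Rightarrow> real) \<Rightarrow> real" where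
  "path_functional X \<omega> \<phi> = (LBINT t:{0..}. X t \<omega> * \<phi> t)"

text \<open>Membership includes integrability of every \<open>X t \<omega> * \<phi> t\<close>, because the Bochner integral
  of a non-integrable function is 0 by convention.\<close>

definition tempered_paths :: "'w measure \<Rightarrow> (real \<Rightarrow> 'w \<Rightarrow> real) \<Rightarrow> 'w set" where
  "tempered_paths M X = {\<omega> \<in> space M.
     (\<forall>\<phi>\<in>schwartz_space. set_integrable lborel {0..} (\<lambda>t. X t \<omega> * \<phi> t)) \<and>
     tempered_distribution (path_functional X \<omega>)}"

end

theory Submission
  imports Defs
begin

text \<open>
  Temperedness of a path is a question of polynomial growth. A measurable path with
  \<open>\<bar>X t\<bar> \<le> C * (1 + t ^ N)\<close> pairs with every Schwartz function \<open>\<phi>\<close>, and the pairing is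
  controlled by four seminorms of \<open>\<phi>\<close>. Conversely a tempered distribution is bounded by finitely
  many seminorms, so its values on the translates \<open>\<psi> (t - n)\<close> of a fixed bump \<open>\<psi>\<close> supported in
  \<open>[0, 1]\<close> grow at most polynomially in \<open>n\<close>. If moreover the path stays within distance \<open>b\<close> of
  \<open>X n\<close> on the interval \<open>[n, n + 1]\<close>, then such a value differs from \<open>X n\<close> times the
  integral of \<open>\<psi>\<close> by at most a constant, so that \<open>X n\<close> itself is bounded polynomially in \<open>n\<close>
  (\<open>tempered_path_growth\<close>).

  The probabilistic link between the oscillation over a unit interval and the law of \<open>X 1\<close> is the
  inequality of Ottaviani, applied to the increments over dyadic grids: for all large \<open>a\<close>,
  uniformly in \<open>j\<close>, the probability that the path moves further than \<open>2 * a\<close> away from \<open>X j\<close> on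
  \<open>[j, j + 1]\<close> is at most twice the probability that \<open>\<bar>X 1\<bar> > a\<close>
  (\<open>oscillates_bound\<close>). Its hypothesis, tightness of the increments over at most one unit of time,
  holds because cadlag paths are bounded on compact intervals.

  With a finite moment of order \<open>\<eta>\<close>, choose \<open>p\<close> with \<open>p * \<eta> \<ge> 2\<close>. By the inequality of Markov and
  the first Borel-Cantelli lemma the oscillation over \<open>[j, j + 1]\<close> is eventually at most
  \<open>2 * j ^ p\<close>, and summing over \<open>j\<close> gives polynomial growth.

  Without finite moments, the probabilities that \<open>\<bar>X 1\<bar> > (k + 1) ^ N\<close> have an infinite sum over
  \<open>k\<close>, for every \<open>N \<ge> 1\<close>. Group the unit intervals in consecutive triples and look for an
  oscillation of at most \<open>b\<close> on the first, an increment larger than \<open>(k + 1) ^ N\<close> over the second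
  and again an oscillation of at most \<open>b\<close> on the third, where \<open>b\<close> is such that the two outer events
  each have probability at least one half. The triples are independent, so almost surely this happens
  for infinitely many \<open>k\<close>, for all \<open>N\<close> at once. On a tempered path the two outer conditions bound
  the values of the path on both sides of the middle interval by a polynomial in \<open>k\<close> of a fixed
  degree, which contradicts the middle condition as soon as \<open>N\<close> exceeds that degree.
\<close>

section \<open>A smooth bump function\<close>

text \<open>The family of all these functions is closed under differentiation, which is why a polynomial and a
power of the denominator are carried along: every iterated derivative of the standard bump
\<^term>\<open>flat_bump 1 0\<close> is again of this form.\<close>

definition flat_bump :: "real poly \<Rightarrow> nat \<Rightarrow> real \<Rightarrow> real" where
  "flat_bump p k x =
     (if 0 < x \<and> x < 1 then poly p x / (x * (1 - x)) ^ k * exp (- 1 / (x * (1 - x))) else 0)"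

lemma exp_neg_inverse_le:
  fixes q :: real
  assumes "0 < q"
  shows "exp (- 1 / q) \<le> fact n * q ^ n"
proof -
  have "(1 / q) ^ n / fact n \<le> exp (1 / q)"
  proof -
    have s: "(\<lambda>k. (1/q) ^ k /\<^sub>R fact k) sums exp (1/q)" by (rule exp_converges)
    have "(\<Sum>k\<in>{n}. (1/q) ^ k /\<^sub>R fact k) \<le> (\<Sum>k. (1/q) ^ k /\<^sub>R fact k)"
      using assms sums_summable[OF s] by (intro sum_le_suminf) (auto simp del: real_scaleR_def intro!: scaleR_nonneg_nonneg)
    then show ?thesis using sums_unique[OF s] by (simp add: field_simps)
  qed
  then show ?thesis using assms by (simp add: exp_minus field_simps)
qed

text \<open>For \<open>y\<close> in the open unit interval, the exponential is smaller than any power of \<open>y * (1 - y)\<close> up to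
a constant, and \<open>y * (1 - y)\<close> is at most the distance of \<open>y\<close> from any
point outside the interval. The square makes the derivative at the end points vanish.\<close>

lemma flat_bump_le_square:
  "\<exists>C\<ge>0. \<forall>x y. \<not> (0 < x \<and> x < 1) \<longrightarrow> \<bar>flat_bump p k y\<bar> \<le> C * (y - x)\<^sup>2"
proof -
  have "compact (poly p ` {0..1})"
    by (intro compact_continuous_image continuous_intros) auto
  then obtain B where B: "\<And>x. x \<in> {0..1} \<Longrightarrow> \<bar>poly p x\<bar> \<le> B" "0 < B"
    using compact_imp_bounded bounded_pos by (metis imageI real_norm_def)
  have "\<bar>flat_bump p k y\<bar> \<le> B * fact (k + 2) * (y - x)\<^sup>2" if x: "\<not> (0 < x \<and> x < 1)" for x y
  proof (cases "0 < y \<and> y < 1")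
    case True
    define q where "q = y * (1 - y)"
    have q: "0 < q" "q \<le> y" "q \<le> 1 - y"
      using True mult_left_le[of "1 - y" y] mult_left_le_one_le[of "1 - y" y] by (auto simp: q_def)
    have "\<bar>flat_bump p k y\<bar> = \<bar>poly p y\<bar> * (exp (- 1 / q) / q ^ k)"
      using True q by (simp add: flat_bump_def q_def[symmetric] abs_mult)
    also have "\<dots> \<le> B * (fact (k + 2) * q ^ (k + 2) / q ^ k)"
      using B(1)[of y] True q exp_neg_inverse_le[OF q(1), of "k + 2"]
      by (intro mult_mono divide_right_mono) auto
    also have "\<dots> = B * fact (k + 2) * q\<^sup>2"
      using q by (simp add: power_add power2_eq_square)
    also have "q \<le> \<bar>y - x\<bar>" using x q True by auto
    then have "B * fact (k + 2) * q\<^sup>2 \<le> B * fact (k + 2) * (y - x)\<^sup>2"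
      using q B by (intro mult_left_mono) (auto simp: abs_le_square_iff[symmetric])
    finally show ?thesis .
  qed (use B in \<open>auto simp: flat_bump_def\<close>)
  then show ?thesis using B by (intro exI[of _ "B * fact (k + 2)"]) auto
qed

lemma DERIV_zero_if_quadratic:
  fixes f :: "real \<Rightarrow> real"
  assumes "\<And>y. \<bar>f y\<bar> \<le> C * (y - x)\<^sup>2"
  shows "(f has_real_derivative 0) (at x)"
proof -
  have f0: "f x = 0" using assms[of x] by simp
  have "((\<lambda>y. (f y - f x) / (y - x)) \<longlongrightarrow> 0) (at x)"
  proof (rule Lim_null_comparison)
    show "\<forall>\<^sub>F y in at x. norm ((f y - f x) / (y - x)) \<le> C * \<bar>y - x\<bar>"
      unfolding eventually_at_filter
    proof (rule eventuallyI, intro impI)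
      fix y assume "y \<noteq> x"
      then have "\<bar>f y\<bar> / \<bar>y - x\<bar> \<le> C * (y - x)\<^sup>2 / \<bar>y - x\<bar>"
        by (intro divide_right_mono assms) auto
      also have "\<dots> = C * \<bar>y - x\<bar>"
        using \<open>y \<noteq> x\<close> by (simp add: power2_eq_square abs_if field_simps)
      finally show "norm ((f y - f x) / (y - x)) \<le> C * \<bar>y - x\<bar>" by (simp add: f0)
    qed
    show "((\<lambda>y. C * \<bar>y - x\<bar>) \<longlongrightarrow> 0) (at x)"
      by (auto intro!: tendsto_eq_intros)
  qed
  then show ?thesis by (simp add: has_field_derivative_iff)
qed

text \<open>Inside the unit interval this is the quotient rule with denominator \<open>q ^ k\<close> and the derivative
\<open>q' / q\<^sup>2\<close> of the exponent \<open>- 1 / q\<close>, over the common denominator \<open>q ^ (k + 2)\<close>.\<close>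

lemma DERIV_flat_bump:
  defines "q \<equiv> [:0, 1, -1 :: real:]"
  shows "(flat_bump p k has_real_derivative
     flat_bump (pderiv p * q\<^sup>2 - smult (real k) (p * pderiv q * q) + p * pderiv q) (k + 2) x) (at x)"
proof (cases "0 < x \<and> x < 1")
  case False
  obtain C where "\<And>x y. \<not> (0 < x \<and> x < 1) \<Longrightarrow> \<bar>flat_bump p k y\<bar> \<le> C * (y - x)\<^sup>2"
    using flat_bump_le_square by blast
  with False have "(flat_bump p k has_real_derivative 0) (at x)"
    by (intro DERIV_zero_if_quadratic) auto
  moreover have "flat_bump p' k' x = 0" for p' k' using False by (auto simp: flat_bump_def)
  ultimately show ?thesis by simp
next
  case True
  have pq: "poly q y = y * (1 - y)" for y by (simp add: q_def algebra_simps)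
  define Q where "Q = poly q x"
  define Q' where "Q' = poly (pderiv q) x"
  have Q: "0 < Q" using True by (simp add: Q_def pq)
  have "((\<lambda>y. poly p y / poly q y ^ k * exp (- 1 / poly q y)) has_real_derivative
      (poly (pderiv p) x * Q ^ k - poly p x * (real k * (Q ^ (k - 1) * Q'))) / (Q ^ k * Q ^ k) * exp (- 1 / Q)
        + exp (- 1 / Q) * (Q' / (Q * Q)) * (poly p x / Q ^ k)) (at x)"
    unfolding Q_def Q'_def
    by (rule derivative_eq_intros poly_DERIV refl | use Q in \<open>simp add: Q_def field_simps\<close>)+
  also have "(poly (pderiv p) x * Q ^ k - poly p x * (real k * (Q ^ (k - 1) * Q'))) / (Q ^ k * Q ^ k) * exp (- 1 / Q)
        + exp (- 1 / Q) * (Q' / (Q * Q)) * (poly p x / Q ^ k)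
     = (poly (pderiv p) x * Q\<^sup>2 - real k * (poly p x * Q' * Q) + poly p x * Q') / Q ^ (k + 2) * exp (- 1 / Q)"
  proof (cases k)
    case (Suc l)
    then show ?thesis using Q by (simp add: field_simps power2_eq_square)
  qed (use Q in \<open>simp add: field_simps power2_eq_square\<close>)
  also have "\<dots> = flat_bump (pderiv p * q\<^sup>2 - smult (real k) (p * pderiv q * q) + p * pderiv q) (k + 2) x"
    using True by (simp add: flat_bump_def Q_def Q'_def pq)
  finally have D: "((\<lambda>y. poly p y / poly q y ^ k * exp (- 1 / poly q y)) has_real_derivative
      flat_bump (pderiv p * q\<^sup>2 - smult (real k) (p * pderiv q * q) + p * pderiv q) (k + 2) x) (at x)" .
  show ?thesis
    by (rule has_field_derivative_transform_within_open[OF D, where S = "{0<..<1}"])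
      (use True in \<open>auto simp: flat_bump_def pq\<close>)
qed

lemma iterated_deriv_flat_bump: "\<exists>p' k'. (deriv ^^ b) (flat_bump p k) = flat_bump p' k'"
proof (induction b)
  case (Suc b)
  then obtain p' k' where "(deriv ^^ b) (flat_bump p k) = flat_bump p' k'" by blast
  moreover have "\<exists>p'' k''. deriv (flat_bump p' k') = flat_bump p'' k''"
    using DERIV_imp_deriv[OF DERIV_flat_bump[of p' k']] by blast
  ultimately show ?case by simp
qed auto

lemma flat_bump_bounded: "\<exists>C. \<forall>x. \<bar>flat_bump p k x\<bar> \<le> C"
proof -
  obtain C where C: "C \<ge> 0" "\<And>x y. \<not> (0 < x \<and> x < 1) \<Longrightarrow> \<bar>flat_bump p k y\<bar> \<le> C * (y - x)\<^sup>2"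
    using flat_bump_le_square by blast
  have "\<bar>flat_bump p k y\<bar> \<le> C" for y
  proof (cases "0 < y \<and> y < 1")
    case True
    then have "C * (y - 0)\<^sup>2 \<le> C * 1"
      using C by (intro mult_left_mono) (auto simp: power_le_one)
    with C(2)[of 0 y] show ?thesis by simp
  qed (use C(1) in \<open>auto simp: flat_bump_def\<close>)
  then show ?thesis by blast
qed

lemma smooth_flat_bump: "smooth_real (flat_bump p k)"
  unfolding smooth_real_def
proof (intro allI)
  fix b x
  obtain p' k' where "(deriv ^^ b) (flat_bump p k) = flat_bump p' k'"
    using iterated_deriv_flat_bump by blast
  then show "(deriv ^^ b) (flat_bump p k) field_differentiable at x"
    using DERIV_flat_bump[of p' k' x] by (auto simp: field_differentiable_def)
qed

section \<open>Seminorms of Schwartz functions\<close>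

lemma iterated_deriv_lincomb:
  fixes f g :: "real \<Rightarrow> real"
  assumes "smooth_real f" "smooth_real g"
  shows "(deriv ^^ k) (\<lambda>x. c * f x + d * g x) = (\<lambda>x. c * (deriv ^^ k) f x + d * (deriv ^^ k) g x)"
proof (induction k)
  case (Suc k)
  have "deriv (\<lambda>x. c * (deriv ^^ k) f x + d * (deriv ^^ k) g x) x =
      c * deriv ((deriv ^^ k) f) x + d * deriv ((deriv ^^ k) g) x" for x
    using assms unfolding smooth_real_def
    by (intro DERIV_imp_deriv DERIV_add DERIV_cmult)
      (auto simp: field_differentiable_derivI)
  then show ?case using Suc by simp
qed auto

lemma schwartz_lincomb:
  assumes f: "f \<in> schwartz_space" and g: "g \<in> schwartz_space"
  shows "(\<lambda>x. c * f x + d * g x) \<in> schwartz_space"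
proof -
  have sm: "smooth_real f" "smooth_real g" using f g by (auto simp: schwartz_space_def)
  note D = iterated_deriv_lincomb[OF sm, of _ c d]
  have "smooth_real (\<lambda>x. c * f x + d * g x)"
    using sm unfolding smooth_real_def D
    by (intro allI field_differentiable_add field_differentiable_mult field_differentiable_const) auto
  moreover have "bounded (range (\<lambda>x. x ^ a * (deriv ^^ b) (\<lambda>x. c * f x + d * g x) x))" for a b
  proof -
    have "bounded ((\<lambda>x. c * (x ^ a * (deriv ^^ b) f x) + d * (x ^ a * (deriv ^^ b) g x)) ` UNIV)"
    proof (rule bounded_plus_comp)
      show "bounded (range (\<lambda>x. c * (x ^ a * (deriv ^^ b) f x)))"
        using f bounded_scaling[of "range (\<lambda>x. x ^ a * (deriv ^^ b) f x)" c]
        by (simp add: schwartz_space_def image_image)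
      show "bounded (range (\<lambda>x. d * (x ^ a * (deriv ^^ b) g x)))"
        using g bounded_scaling[of "range (\<lambda>x. x ^ a * (deriv ^^ b) g x)" d]
        by (simp add: schwartz_space_def image_image)
    qed
    then show ?thesis unfolding D by (simp add: algebra_simps)
  qed
  ultimately show ?thesis by (simp add: schwartz_space_def)
qed

lemma schwartz_seminorm_upper:
  assumes "f \<in> schwartz_space"
  shows "\<bar>x ^ a * (deriv ^^ b) f x\<bar> \<le> schwartz_seminorm a b f"
proof -
  have "bounded (range (\<lambda>x. x ^ a * (deriv ^^ b) f x))" using assms by (simp add: schwartz_space_def)
  then have "bounded (range (\<lambda>x. \<bar>x ^ a * (deriv ^^ b) f x\<bar>))"
    by (auto simp: bounded_iff)
  then show ?thesis unfolding schwartz_seminorm_def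
    by (intro cSUP_upper bounded_imp_bdd_above) auto
qed

lemma schwartz_seminorm_least:
  assumes "\<And>x. \<bar>x ^ a * (deriv ^^ b) f x\<bar> \<le> B"
  shows "schwartz_seminorm a b f \<le> B"
  unfolding schwartz_seminorm_def using assms by (intro cSUP_least) auto

lemma schwartz_seminorm_nonneg: "f \<in> schwartz_space \<Longrightarrow> 0 \<le> schwartz_seminorm a b f"
  using schwartz_seminorm_upper[of f 0 a b] by (meson abs_ge_zero order_trans)

lemma schwartz_seminorm_lincomb:
  assumes "f \<in> schwartz_space" "g \<in> schwartz_space"
  shows "schwartz_seminorm a b (\<lambda>x. c * f x + d * g x) \<le>
    \<bar>c\<bar> * schwartz_seminorm a b f + \<bar>d\<bar> * schwartz_seminorm a b g"
proof (rule schwartz_seminorm_least)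
  fix x
  have sm: "smooth_real f" "smooth_real g" using assms by (auto simp: schwartz_space_def)
  have "\<bar>x ^ a * (deriv ^^ b) (\<lambda>x. c * f x + d * g x) x\<bar> =
      \<bar>c * (x ^ a * (deriv ^^ b) f x) + d * (x ^ a * (deriv ^^ b) g x)\<bar>"
    by (simp add: iterated_deriv_lincomb[OF sm] algebra_simps)
  also have "\<dots> \<le> \<bar>c\<bar> * \<bar>x ^ a * (deriv ^^ b) f x\<bar> + \<bar>d\<bar> * \<bar>x ^ a * (deriv ^^ b) g x\<bar>"
    by (metis abs_mult abs_triangle_ineq)
  also have "\<dots> \<le> \<bar>c\<bar> * schwartz_seminorm a b f + \<bar>d\<bar> * schwartz_seminorm a b g"
    using assms by (intro add_mono mult_left_mono schwartz_seminorm_upper) auto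
  finally show "\<bar>x ^ a * (deriv ^^ b) (\<lambda>x. c * f x + d * g x) x\<bar> \<le>
    \<bar>c\<bar> * schwartz_seminorm a b f + \<bar>d\<bar> * schwartz_seminorm a b g" .
qed

text \<open>The seminorm balls that generate the topology may be centred anywhere. A ball that contains the zero
function also contains, by the triangle inequality, a ball of the same seminorm around it; the
property then passes through finite intersections and arbitrary unions.\<close>

lemma schwartz_nbhd_zero:
  assumes "openin schwartz_topology U" and "(\<lambda>x. 0) \<in> U"
  shows "\<exists>N. \<exists>\<delta>>0. \<forall>\<psi>\<in>schwartz_space.
    (\<forall>a\<le>N. \<forall>b\<le>N. schwartz_seminorm a b \<psi> < \<delta>) \<longrightarrow> \<psi> \<in> U"
  using openin_topology_generated_by[OF assms(1)[unfolded schwartz_topology_def]] assms(2)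
proof induction
  case (Int U V)
  then have z: "(\<lambda>x. 0) \<in> U" "(\<lambda>x. 0) \<in> V" by auto
  obtain N \<delta> where U: "\<delta> > 0" "\<forall>\<psi>\<in>schwartz_space.
      (\<forall>a\<le>N. \<forall>b\<le>N. schwartz_seminorm a b \<psi> < \<delta>) \<longrightarrow> \<psi> \<in> U"
    using Int.IH(1)[OF z(1)] by blast
  obtain N' \<delta>' where V: "\<delta>' > 0" "\<forall>\<psi>\<in>schwartz_space.
      (\<forall>a\<le>N'. \<forall>b\<le>N'. schwartz_seminorm a b \<psi> < \<delta>') \<longrightarrow> \<psi> \<in> V"
    using Int.IH(2)[OF z(2)] by blast
  show ?case
    by (rule exI[of _ "max N N'"], rule exI[of _ "min \<delta> \<delta>'"]) (use U V in auto)
next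
  case (UN K)
  then obtain V where "V \<in> K" "(\<lambda>x. 0) \<in> V" by blast
  with UN.IH[OF this] show ?case by blast
next
  case (Basis S)
  then obtain \<phi> a b e where S: "S = {\<psi> \<in> schwartz_space. schwartz_seminorm a b (\<lambda>x. \<psi> x - \<phi> x) < e}"
    and \<phi>: "\<phi> \<in> schwartz_space" by blast
  have e: "schwartz_seminorm a b (\<lambda>x. 0 - \<phi> x) < e" and z: "(\<lambda>x. 0) \<in> schwartz_space"
    using Basis(2) unfolding S by auto
  have m: "(\<lambda>x. 0 - \<phi> x) \<in> schwartz_space" using schwartz_lincomb[OF z \<phi>, of 1 "-1"] by simp
  show ?case
  proof (intro exI[of _ "max a b"] exI[of _ "e - schwartz_seminorm a b (\<lambda>x. 0 - \<phi> x)"] conjI ballI impI)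
    fix \<psi> assume \<psi>: "\<psi> \<in> schwartz_space" and
      sm: "\<forall>a'\<le>max a b. \<forall>b'\<le>max a b. schwartz_seminorm a' b' \<psi> < e - schwartz_seminorm a b (\<lambda>x. 0 - \<phi> x)"
    have "schwartz_seminorm a b (\<lambda>x. 1 * \<psi> x + 1 * (0 - \<phi> x)) \<le>
        \<bar>1\<bar> * schwartz_seminorm a b \<psi> + \<bar>1\<bar> * schwartz_seminorm a b (\<lambda>x. 0 - \<phi> x)"
      by (rule schwartz_seminorm_lincomb[OF \<psi> m])
    also have "\<dots> < e" using sm[rule_format, of a b] by simp
    finally show "\<psi> \<in> S" using \<psi> by (simp add: S)
  qed (use e in simp)
qed auto

lemma schwartz_measurable:
  assumes "f \<in> schwartz_space" shows "f \<in> borel_measurable borel"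
proof -
  have "f field_differentiable at x" for x
    using assms unfolding schwartz_space_def smooth_real_def by (auto dest: spec[of _ 0])
  then have "continuous_on UNIV f"
    by (intro continuous_at_imp_continuous_on ballI field_differentiable_imp_continuous_at)
  then show ?thesis by (rule borel_measurable_continuous_onI)
qed

section \<open>Translated bumps\<close>

definition shifted_bump :: "nat \<Rightarrow> real \<Rightarrow> real" where
  "shifted_bump n x = flat_bump 1 0 (x - real n)"

lemma iterated_deriv_shift:
  fixes f :: "real \<Rightarrow> real"
  assumes "smooth_real f"
  shows "(deriv ^^ b) (\<lambda>x. f (x - c)) = (\<lambda>x. (deriv ^^ b) f (x - c))"
proof (induction b)
  case (Suc b)
  have "deriv (\<lambda>x. (deriv ^^ b) f (x - c)) x = deriv ((deriv ^^ b) f) (x - c)" for x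
  proof -
    have "((deriv ^^ b) f has_field_derivative deriv ((deriv ^^ b) f) (x - c)) (at (x - c))"
      using assms by (simp add: smooth_real_def field_differentiable_derivI)
    then have "((\<lambda>x. (deriv ^^ b) f (x - c)) has_field_derivative deriv ((deriv ^^ b) f) (x - c)) (at x)"
      using DERIV_shift[of "(deriv ^^ b) f" _ x "-c"] by simp
    then show ?thesis by (rule DERIV_imp_deriv)
  qed
  then show ?case using Suc by simp
qed auto

text \<open>The derivatives do not grow under translation; only the weight \<open>x ^ a\<close> does, and it is at most
\<open>(n + 1) ^ a\<close> on the support.\<close>

lemma shifted_bump_derivs_bounded:
  "\<exists>H\<ge>0. \<forall>b\<le>N. \<forall>a\<le>N. \<forall>n x. \<bar>x ^ a * (deriv ^^ b) (shifted_bump n) x\<bar> \<le> H * (real n + 1) ^ N"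
proof -
  have "\<exists>C. \<forall>x. \<bar>(deriv ^^ b) (flat_bump 1 0) x\<bar> \<le> C" for b
    using iterated_deriv_flat_bump[of b 1 0] flat_bump_bounded by metis
  then obtain C where C: "\<And>b x. \<bar>(deriv ^^ b) (flat_bump 1 0) x\<bar> \<le> C b" by metis
  have C0: "0 \<le> C b" for b using C[of b 0] by linarith
  have "\<bar>x ^ a * (deriv ^^ b) (shifted_bump n) x\<bar> \<le> (\<Sum>b\<le>N. C b) * (real n + 1) ^ N"
    if "b \<le> N" "a \<le> N" for a b n x
  proof -
    obtain p k where pk: "(deriv ^^ b) (flat_bump 1 0) = flat_bump p k"
      using iterated_deriv_flat_bump by blast
    have eq: "(deriv ^^ b) (shifted_bump n) x = (deriv ^^ b) (flat_bump 1 0) (x - real n)"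
      using iterated_deriv_shift[OF smooth_flat_bump[of 1 0], of b "real n"]
      by (simp add: shifted_bump_def[abs_def])
    show ?thesis
    proof (cases "real n < x \<and> x < real n + 1")
      case True
      have "C b \<le> (\<Sum>b\<le>N. C b)" using that C0 by (intro member_le_sum) auto
      moreover have "\<bar>x\<bar> ^ a \<le> (real n + 1) ^ N"
        using True that
        by (intro order_trans[OF power_mono power_increasing]) auto
      moreover have "\<bar>(deriv ^^ b) (shifted_bump n) x\<bar> \<le> C b" using C eq by simp
      ultimately have "\<bar>x\<bar> ^ a * \<bar>(deriv ^^ b) (shifted_bump n) x\<bar> \<le> (real n + 1) ^ N * (\<Sum>b\<le>N. C b)"
        by (intro mult_mono) auto
      then show ?thesis by (simp add: abs_mult power_abs mult.commute)
    next
      case False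
      then have "(deriv ^^ b) (shifted_bump n) x = 0" by (auto simp: eq pk flat_bump_def)
      then show ?thesis using C0 by (simp add: sum_nonneg)
    qed
  qed
  then show ?thesis using C0 by (intro exI[of _ "\<Sum>b\<le>N. C b"]) (auto intro: sum_nonneg)
qed

lemma shifted_bump_schwartz: "shifted_bump n \<in> schwartz_space"
proof -
  have "smooth_real (shifted_bump n)"
    unfolding smooth_real_def
  proof (intro allI)
    fix b x
    obtain p k where pk: "(deriv ^^ b) (flat_bump 1 0) = flat_bump p k"
      using iterated_deriv_flat_bump by blast
    have "(deriv ^^ b) (shifted_bump n) = (\<lambda>x. flat_bump p k (x - real n))"
      using iterated_deriv_shift[OF smooth_flat_bump[of 1 0], of b "real n"]
      by (simp add: shifted_bump_def[abs_def] pk)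
    then show "(deriv ^^ b) (shifted_bump n) field_differentiable at x"
      using DERIV_flat_bump[of p k "x - real n"] DERIV_shift[of "flat_bump p k" _ x "- real n"]
      by (auto simp: field_differentiable_def)
  qed
  moreover have "bounded (range (\<lambda>x. x ^ a * (deriv ^^ b) (shifted_bump n) x))" for a b
  proof -
    obtain H where "\<And>x. \<bar>x ^ a * (deriv ^^ b) (shifted_bump n) x\<bar> \<le> H * (real n + 1) ^ (max a b)"
      using shifted_bump_derivs_bounded[of "max a b"] by (meson max.cobounded1 max.cobounded2)
    then show ?thesis by (auto simp: bounded_iff)
  qed
  ultimately show ?thesis by (simp add: schwartz_space_def)
qed

lemma shifted_bump_nonneg: "0 \<le> shifted_bump n x"
  by (simp add: shifted_bump_def flat_bump_def)

lemma shifted_bump_outside: "\<not> (real n < x \<and> x < real n + 1) \<Longrightarrow> shifted_bump n x = 0"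
  by (auto simp: shifted_bump_def flat_bump_def)

lemma integrable_shifted_bump: "integrable lborel (shifted_bump n)"
proof -
  obtain C where C: "\<And>x. \<bar>flat_bump 1 0 x\<bar> \<le> C" using flat_bump_bounded by blast
  have "integrable lborel (\<lambda>x. indicator {real n..real n + 1} x *\<^sub>R shifted_bump n x)"
    using schwartz_measurable[OF shifted_bump_schwartz[of n]] C[of "_ - real n"]
    by (intro integrableI_bounded_set_indicator[where B = C]) (auto simp: shifted_bump_def[abs_def])
  moreover have "(\<lambda>x. indicator {real n..real n + 1} x *\<^sub>R shifted_bump n x) = shifted_bump n"
  proof
    fix x show "indicator {real n..real n + 1} x *\<^sub>R shifted_bump n x = shifted_bump n x"
      using shifted_bump_outside[of n x] by (cases "real n < x \<and> x < real n + 1") (auto simp: indicator_def)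
  qed
  ultimately show ?thesis by simp
qed

lemma integral_shifted_bump: "(LBINT x. shifted_bump n x) = (LBINT x. shifted_bump 0 x)"
  using lborel_integral_real_affine[of 1 "shifted_bump 0" "- real n"]
  by (simp add: shifted_bump_def)

lemma integral_shifted_bump_pos: "0 < (LBINT x. shifted_bump 0 x)"
proof -
  have "(LBINT x. shifted_bump 0 x) \<noteq> 0"
  proof
    assume "(LBINT x. shifted_bump 0 x) = 0"
    then have "AE x in lborel. shifted_bump 0 x = 0"
      using integral_nonneg_eq_0_iff_AE[OF integrable_shifted_bump[of 0]] shifted_bump_nonneg by simp
    moreover have "x \<notin> {0<..<1}" if "shifted_bump 0 x = 0" for x
      using that by (auto simp: shifted_bump_def flat_bump_def)
    ultimately have "AE x in lborel. x \<notin> {0<..<1::real}" by (auto elim: eventually_mono)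
    then have "emeasure lborel {0<..<1::real} = 0"
      by (subst (asm) AE_iff_measurable[of "{0<..<1}"]) auto
    then show False by simp
  qed
  moreover have "0 \<le> (LBINT x. shifted_bump 0 x)" by (intro integral_nonneg_AE AE_I2 shifted_bump_nonneg)
  ultimately show ?thesis by simp
qed

section \<open>Growth of paths and temperedness\<close>

text \<open>The \<open>n\<close>-th translate, scaled down by a power of \<open>n + 1\<close>, lies in a neighbourhood of zero on which
the functional is bounded by 1; homogeneity undoes the scaling.\<close>

lemma tempered_shifted_bump_growth:
  assumes T: "tempered_distribution T"
  shows "\<exists>C N. \<forall>n. \<bar>T (shifted_bump n)\<bar> \<le> C * (real n + 1) ^ N"
proof -
  have cont: "continuous_map schwartz_topology euclideanreal T"
    and hom: "\<And>c \<phi>. \<phi>\<in>schwartz_space \<Longrightarrow> T (\<lambda>x. c * \<phi> x) = c * T \<phi>"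
    using T by (auto simp: tempered_distribution_def)
  define U where "U = {\<phi> \<in> topspace schwartz_topology. T \<phi> \<in> {-1<..<1}}"
  have "openin schwartz_topology U" unfolding U_def
    by (rule openin_continuous_map_preimage[OF cont]) auto
  moreover have z: "(\<lambda>x. 0) \<in> schwartz_space"
    using schwartz_lincomb[OF shifted_bump_schwartz shifted_bump_schwartz, of 0 _ 0] by simp
  then have "T (\<lambda>x. 0) = 0" using hom[OF z, of 0] by simp
  then have "(\<lambda>x. 0) \<in> U" using z by (simp add: U_def topspace_schwartz_topology)
  ultimately obtain N \<delta> where \<delta>: "\<delta> > 0" and N: "\<And>\<psi>. \<psi>\<in>schwartz_space \<Longrightarrow>
    (\<And>a b. a\<le>N \<Longrightarrow> b\<le>N \<Longrightarrow> schwartz_seminorm a b \<psi> < \<delta>) \<Longrightarrow> \<psi> \<in> U"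
    using schwartz_nbhd_zero by meson
  obtain H where H: "H \<ge> 0" "\<And>a b n x. b\<le>N \<Longrightarrow> a\<le>N \<Longrightarrow>
      \<bar>x ^ a * (deriv ^^ b) (shifted_bump n) x\<bar> \<le> H * (real n + 1) ^ N"
    using shifted_bump_derivs_bounded[of N] by meson
  have "\<bar>T (shifted_bump n)\<bar> \<le> (H + 1) / \<delta> * (real n + 1) ^ N" for n
  proof -
    \<comment> \<open>The \<open>1\<close> added to \<open>H\<close> makes the seminorms strictly smaller than \<open>\<delta>\<close> and \<open>r\<close> finite.\<close>
    define r where "r = \<delta> / ((H + 1) * (real n + 1) ^ N)"
    have r: "r > 0" using \<delta> H(1) by (simp add: r_def)
    have mem: "(\<lambda>x. r * shifted_bump n x) \<in> schwartz_space"
      using schwartz_lincomb[OF shifted_bump_schwartz shifted_bump_schwartz, of r n 0 n] by simp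
    have "(\<lambda>x. r * shifted_bump n x) \<in> U"
    proof (rule N[OF mem])
      fix a b assume ab: "a \<le> N" "b \<le> N"
      have "schwartz_seminorm a b (\<lambda>x. r * shifted_bump n x) \<le> \<bar>r\<bar> * schwartz_seminorm a b (shifted_bump n)"
        using schwartz_seminorm_lincomb[OF shifted_bump_schwartz shifted_bump_schwartz, of a b r n 0 n] by simp
      also have "\<dots> \<le> r * (H * (real n + 1) ^ N)"
        using r ab H(2) by (auto intro!: mult_left_mono schwartz_seminorm_least)
      also have "\<dots> < r * ((H + 1) * (real n + 1) ^ N)"
        using r by (intro mult_strict_left_mono mult_strict_right_mono) auto
      also have "\<dots> = \<delta>" using H(1) by (simp add: r_def)
      finally show "schwartz_seminorm a b (\<lambda>x. r * shifted_bump n x) < \<delta>" .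
    qed
    then have "\<bar>r * T (shifted_bump n)\<bar> < 1"
      using hom[OF shifted_bump_schwartz, of r n] by (auto simp: U_def)
    then have "\<bar>T (shifted_bump n)\<bar> \<le> 1 / r"
      using r by (simp add: abs_mult field_simps)
    also have "1 / r = (H + 1) / \<delta> * (real n + 1) ^ N" by (simp add: r_def)
    finally show ?thesis .
  qed
  then show ?thesis by blast
qed

lemma integrable_inverse_1_plus_square_lborel:
  "integrable lborel (\<lambda>x::real. inverse (1 + x\<^sup>2))"
  using integrable_inverse_1_plus_square by (simp add: set_integrable_def)

text \<open>Multiplying \<open>\<bar>X t\<bar> * \<bar>\<phi> t\<bar>\<close> by \<open>1 + t ^ 2\<close> gives at most \<open>C\<close> times the sum of the seminorms of
\<open>\<phi>\<close> for the weights \<open>1\<close>, \<open>t ^ 2\<close>, \<open>t ^ N\<close> and \<open>t ^ (N + 2)\<close>, so the product is dominated by a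
multiple of the integrable function \<open>1 / (1 + t ^ 2)\<close>.\<close>

lemma path_functional_tempered:
  assumes meas: "(\<lambda>t. indicator {0..} t * X t \<omega>) \<in> borel_measurable borel"
    and bd: "\<And>t. 0 \<le> t \<Longrightarrow> \<bar>X t \<omega>\<bar> \<le> C * (1 + t ^ N)"
  shows "(\<forall>\<phi>\<in>schwartz_space. set_integrable lborel {0..} (\<lambda>t. X t \<omega> * \<phi> t)) \<and>
     tempered_distribution (path_functional X \<omega>)"
proof -
  \<comment> \<open>The four weights arise from expanding \<open>(1 + t ^ N) * (1 + t ^ 2)\<close>.\<close>
  define p where "p \<phi> = (schwartz_seminorm 0 0 \<phi> + schwartz_seminorm 2 0 \<phi>
      + schwartz_seminorm N 0 \<phi> + schwartz_seminorm (N + 2) 0 \<phi>)" for \<phi>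
  have C: "0 \<le> C" using bd[of 1] by simp
  have pt: "\<bar>indicator {0..} t * (X t \<omega> * \<phi> t)\<bar> \<le> C * p \<phi> * inverse (1 + t\<^sup>2)"
    if \<phi>: "\<phi> \<in> schwartz_space" for \<phi> t
  proof (cases "0 \<le> t")
    case True
    have "\<bar>X t \<omega>\<bar> * \<bar>\<phi> t\<bar> * (1 + t\<^sup>2) \<le> C * (1 + t ^ N) * \<bar>\<phi> t\<bar> * (1 + t\<^sup>2)"
      using bd[OF True] by (intro mult_right_mono) auto
    also have "\<dots> = C * (\<bar>t ^ 0 * (deriv ^^ 0) \<phi> t\<bar> + \<bar>t ^ 2 * (deriv ^^ 0) \<phi> t\<bar>
        + \<bar>t ^ N * (deriv ^^ 0) \<phi> t\<bar> + \<bar>t ^ (N + 2) * (deriv ^^ 0) \<phi> t\<bar>)"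
      using True by (simp add: abs_mult power_add power2_eq_square algebra_simps)
    also have "\<dots> \<le> C * p \<phi>"
      unfolding p_def using C by (intro mult_left_mono add_mono schwartz_seminorm_upper[OF \<phi>]) auto
    finally have "\<bar>X t \<omega>\<bar> * \<bar>\<phi> t\<bar> * (1 + t\<^sup>2) \<le> C * p \<phi>" .
    moreover have "0 < 1 + t\<^sup>2" by (simp add: add_pos_nonneg)
    ultimately have "\<bar>X t \<omega>\<bar> * \<bar>\<phi> t\<bar> \<le> C * p \<phi> / (1 + t\<^sup>2)" by (simp add: pos_le_divide_eq)
    then show ?thesis using True by (simp add: abs_mult divide_inverse)
  next
    case False
    have "0 \<le> p \<phi>" using schwartz_seminorm_nonneg[OF \<phi>] by (simp add: p_def)
    then show ?thesis using False C by simp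
  qed
  have int: "set_integrable lborel {0..} (\<lambda>t. X t \<omega> * \<phi> t)" if \<phi>: "\<phi> \<in> schwartz_space" for \<phi>
    unfolding set_integrable_def
  proof (rule Bochner_Integration.integrable_bound)
    show "integrable lborel (\<lambda>t. C * p \<phi> * inverse (1 + t\<^sup>2))"
      by (intro integrable_mult_right integrable_inverse_1_plus_square_lborel)
    have "(\<lambda>t. indicator {0..} t * X t \<omega> * \<phi> t) \<in> borel_measurable borel"
      using meas schwartz_measurable[OF \<phi>] by (rule borel_measurable_times)
    then show "(\<lambda>t. indicator {0..} t *\<^sub>R (X t \<omega> * \<phi> t)) \<in> borel_measurable lborel"
      by (simp add: mult.assoc)
    show "AE t in lborel. norm (indicator {0..} t *\<^sub>R (X t \<omega> * \<phi> t)) \<le> norm (C * p \<phi> * inverse (1 + t\<^sup>2))"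
      using pt[OF \<phi>] by (intro AE_I2) (simp, metis abs_ge_self order_trans)
  qed
  define K where "K = (LBINT t. inverse (1 + t\<^sup>2 :: real))"
  have K0: "0 \<le> K" unfolding K_def by (intro integral_nonneg_AE) (auto simp: add_nonneg_nonneg)
  have bound: "\<bar>path_functional X \<omega> \<phi>\<bar> \<le> C * K * p \<phi>" if \<phi>: "\<phi> \<in> schwartz_space" for \<phi>
  proof -
    have "\<bar>path_functional X \<omega> \<phi>\<bar> \<le> (LBINT t. C * p \<phi> * inverse (1 + t\<^sup>2))"
      unfolding path_functional_def set_lebesgue_integral_def
      using int[OF \<phi>] pt[OF \<phi>] integrable_inverse_1_plus_square_lborel
      by (intro order_trans[OF integral_abs_bound integral_mono]) (auto simp: set_integrable_def)
    then show ?thesis by (simp add: K_def mult_ac)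
  qed
  have lin: "path_functional X \<omega> (\<lambda>x. c * \<phi> x + d * \<psi> x) =
      c * path_functional X \<omega> \<phi> + d * path_functional X \<omega> \<psi>"
    if "\<phi> \<in> schwartz_space" "\<psi> \<in> schwartz_space" for c d \<phi> \<psi>
  proof -
    have "path_functional X \<omega> (\<lambda>x. c * \<phi> x + d * \<psi> x) =
      (LBINT t:{0..}. c * (X t \<omega> * \<phi> t) + d * (X t \<omega> * \<psi> t))"
      by (simp add: path_functional_def algebra_simps)
    also have "\<dots> = (LBINT t:{0..}. c * (X t \<omega> * \<phi> t)) + (LBINT t:{0..}. d * (X t \<omega> * \<psi> t))"
      using int[OF that(1)] int[OF that(2)] by (intro set_integral_add) auto
    finally show ?thesis by (simp add: path_functional_def)
  qed
  have z: "(\<lambda>x. 0) \<in> schwartz_space"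
    using schwartz_lincomb[OF shifted_bump_schwartz shifted_bump_schwartz, of 0 _ 0] by simp
  have "continuous_map schwartz_topology euclideanreal (path_functional X \<omega>)"
    unfolding continuous_map_def topspace_schwartz_topology
  proof (intro conjI allI impI)
    fix V :: "real set" assume "openin euclideanreal V"
    then have V: "open V" by simp
    show "openin schwartz_topology {\<phi> \<in> schwartz_space. path_functional X \<omega> \<phi> \<in> V}"
    proof (subst openin_subopen, intro ballI)
      fix \<phi> assume "\<phi> \<in> {\<phi> \<in> schwartz_space. path_functional X \<omega> \<phi> \<in> V}"
      then have \<phi>: "\<phi> \<in> schwartz_space" "path_functional X \<omega> \<phi> \<in> V" by auto
      obtain e where e: "e > 0" "\<And>y. \<bar>y - path_functional X \<omega> \<phi>\<bar> < e \<Longrightarrow> y \<in> V"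
        using V \<phi>(2) by (auto simp: open_dist dist_real_def)
      define d where "d = e / (4 * (C * K + 1))"
      have d: "d > 0" using e C K0 by (auto simp: d_def intro!: divide_pos_pos add_nonneg_pos)
      define B where "B a = {\<psi> \<in> schwartz_space. schwartz_seminorm a 0 (\<lambda>x. \<psi> x - \<phi> x) < d}" for a
      have oB: "openin schwartz_topology (B a)" for a
        unfolding schwartz_topology_def B_def using \<phi> d
        by (intro topology_generated_by_Basis) blast
      have "schwartz_seminorm a 0 (\<lambda>x. 0) = 0" for a by (simp add: schwartz_seminorm_def)
      then have B\<phi>: "\<phi> \<in> B a" for a using \<phi> d by (simp add: B_def)
      show "\<exists>T. openin schwartz_topology T \<and> \<phi> \<in> T \<and> T \<subseteq> {\<phi> \<in> schwartz_space. path_functional X \<omega> \<phi> \<in> V}"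
      proof (intro exI[of _ "B 0 \<inter> B 2 \<inter> B N \<inter> B (N + 2)"] conjI subsetI)
        fix \<psi> assume \<psi>: "\<psi> \<in> B 0 \<inter> B 2 \<inter> B N \<inter> B (N + 2)"
        then have \<psi>S: "\<psi> \<in> schwartz_space" by (auto simp: B_def)
        have S: "(\<lambda>x. \<psi> x - \<phi> x) \<in> schwartz_space"
          using schwartz_lincomb[OF \<psi>S \<phi>(1), of 1 "-1"] by simp
        have "p (\<lambda>x. \<psi> x - \<phi> x) \<le> 4 * d" using \<psi> by (simp add: B_def p_def)
        then have "C * K * p (\<lambda>x. \<psi> x - \<phi> x) \<le> C * K * (4 * d)"
          using C K0 by (intro mult_left_mono) auto
        also have "\<dots> < (C * K + 1) * (4 * d)" using d by simp
        also have "\<dots> = e"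
          unfolding d_def using add_nonneg_pos[of "C * K" 1] C K0
            nonzero_mult_div_cancel_left[of "4 * (C * K + 1)" e]
          by (simp add: mult.assoc mult.left_commute del: distrib_left_numeral)
        finally have "\<bar>path_functional X \<omega> (\<lambda>x. \<psi> x - \<phi> x)\<bar> < e" using bound[OF S] by simp
        moreover have "path_functional X \<omega> (\<lambda>x. \<psi> x - \<phi> x) = path_functional X \<omega> \<psi> - path_functional X \<omega> \<phi>"
          using lin[OF \<psi>S \<phi>(1), of 1 "-1"] by simp
        ultimately show "\<psi> \<in> {\<phi> \<in> schwartz_space. path_functional X \<omega> \<phi> \<in> V}"
          using e(2) \<psi>S by simp
      qed (use oB B\<phi> in \<open>auto intro!: openin_Int\<close>)
    qed
  qed auto
  moreover have "path_functional X \<omega> (\<lambda>x. \<phi> x + \<psi> x) = path_functional X \<omega> \<phi> + path_functional X \<omega> \<psi>"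
    if "\<phi> \<in> schwartz_space" "\<psi> \<in> schwartz_space" for \<phi> \<psi>
    using lin[OF that, of 1 1] by simp
  moreover have "path_functional X \<omega> (\<lambda>x. c * \<phi> x) = c * path_functional X \<omega> \<phi>"
    if "\<phi> \<in> schwartz_space" for \<phi> c
    using lin[OF that that, of c 0] by simp
  ultimately show ?thesis using int by (auto simp: tempered_distribution_def)
qed

text \<open>Testing against the bump over \<open>[n, n + 1]\<close> replaces the path by a weighted mean of its values there,
which is within \<open>b\<close> of \<open>X n\<close>. The constants \<open>C\<close> and \<open>N\<close> depend on the path alone, not on \<open>n\<close> and
\<open>b\<close>.\<close>

lemma tempered_path_growth:
  assumes \<omega>: "\<omega> \<in> tempered_paths M X"
  shows "\<exists>C N. 0 \<le> C \<and> (\<forall>n b. (\<forall>t. real n \<le> t \<longrightarrow> t \<le> real n + 1 \<longrightarrow> \<bar>X t \<omega> - X (real n) \<omega>\<bar> \<le> b) \<longrightarrow>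
    \<bar>X (real n) \<omega>\<bar> \<le> C * (real n + 1) ^ N + b)"
proof -
  define I where "I = (LBINT x. shifted_bump 0 x)"
  have I: "0 < I" using integral_shifted_bump_pos by (simp add: I_def)
  have int: "set_integrable lborel {0..} (\<lambda>t. X t \<omega> * \<phi> t)" if "\<phi> \<in> schwartz_space" for \<phi>
    using \<omega> that by (auto simp: tempered_paths_def)
  obtain C N where C: "\<And>n. \<bar>path_functional X \<omega> (shifted_bump n)\<bar> \<le> C * (real n + 1) ^ N"
    using tempered_shifted_bump_growth \<omega> unfolding tempered_paths_def by blast
  have C0: "0 \<le> C" using C[of 0] by simp
  have "\<bar>X (real n) \<omega>\<bar> \<le> C / I * (real n + 1) ^ N + b"
    if b: "\<forall>t. real n \<le> t \<longrightarrow> t \<le> real n + 1 \<longrightarrow> \<bar>X t \<omega> - X (real n) \<omega>\<bar> \<le> b" for n b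
  proof -
    let ?\<phi> = "shifted_bump n"
    have eq: "indicator {0..} t *\<^sub>R (X t \<omega> * ?\<phi> t) - X (real n) \<omega> * ?\<phi> t = (X t \<omega> - X (real n) \<omega>) * ?\<phi> t" for t
      using shifted_bump_outside[of n t] by (cases "0 \<le> t") (auto simp: algebra_simps)
    have i1: "integrable lborel (\<lambda>t. indicator {0..} t *\<^sub>R (X t \<omega> * ?\<phi> t))"
      using int[OF shifted_bump_schwartz] by (simp add: set_integrable_def)
    have i2: "integrable lborel (\<lambda>t. X (real n) \<omega> * ?\<phi> t)" using integrable_shifted_bump by simp
    have i3: "integrable lborel (\<lambda>t. (X t \<omega> - X (real n) \<omega>) * ?\<phi> t)"
      using Bochner_Integration.integrable_diff[OF i1 i2] by (simp only: eq)
    have "path_functional X \<omega> ?\<phi> - X (real n) \<omega> * I = (LBINT t. (X t \<omega> - X (real n) \<omega>) * ?\<phi> t)"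
      using Bochner_Integration.integral_diff[OF i1 i2] unfolding eq
      by (simp add: path_functional_def set_lebesgue_integral_def I_def integral_shifted_bump[of n])
    also have "\<bar>\<dots>\<bar> \<le> (LBINT t. b * ?\<phi> t)"
    proof (rule order_trans[OF integral_abs_bound integral_mono])
      show "\<bar>(X t \<omega> - X (real n) \<omega>) * ?\<phi> t\<bar> \<le> b * ?\<phi> t" for t
      proof (cases "real n < t \<and> t < real n + 1")
        case True
        then show ?thesis using b shifted_bump_nonneg[of n t] by (simp add: abs_mult mult_right_mono)
      qed (simp add: shifted_bump_outside)
    qed (use i3 integrable_shifted_bump in auto)
    also have "\<dots> = b * I" by (simp add: I_def integral_shifted_bump[of n])
    finally have "\<bar>X (real n) \<omega> * I\<bar> \<le> C * (real n + 1) ^ N + b * I" using C[of n] by linarith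
    then have "\<bar>X (real n) \<omega>\<bar> \<le> (C * (real n + 1) ^ N + b * I) / I"
      using I by (simp add: abs_mult pos_le_divide_eq)
    also have "\<dots> = C / I * (real n + 1) ^ N + b" using I by (simp add: field_simps)
    finally show ?thesis .
  qed
  then show ?thesis using I C0 by (intro exI[of _ "C / I"] exI[of _ N]) auto
qed

section \<open>Cadlag functions and dyadic times\<close>

text \<open>One-sided limits make the function bounded near every point, and compactness of the interval
globalises this; the bisection principle \<open>Bolzano\<close> takes the place of a covering argument. Left
neighbourhoods are cut off at 0, where nothing is known about the function.\<close>

lemma cadlag_bounded:
  assumes "cadlag f"
  shows "\<exists>B. \<forall>t\<in>{0..T}. \<bar>f t\<bar> \<le> B"
proof (cases "0 \<le> T")
  case True
  define P where "P a b \<longleftrightarrow> (\<exists>B. \<forall>t\<in>{a..b} \<inter> {0..T}. \<bar>f t\<bar> \<le> B)" for a b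
  have "P 0 T"
  proof (rule Bolzano[OF True])
    fix a b c assume "P a b" "P b c" "a \<le> b" "b \<le> c"
    then obtain B B' where "\<forall>t\<in>{a..b} \<inter> {0..T}. \<bar>f t\<bar> \<le> B" "\<forall>t\<in>{b..c} \<inter> {0..T}. \<bar>f t\<bar> \<le> B'"
      unfolding P_def by blast
    then have "\<forall>t\<in>{a..c} \<inter> {0..T}. \<bar>f t\<bar> \<le> max B B'"
      by (metis IntD1 IntD2 IntI atLeastAtMost_iff le_max_iff_disj linear)
    then show "P a c" unfolding P_def by blast
  next
    fix x assume x: "0 \<le> x" "x \<le> T"
    have lim: "\<exists>d>0. \<forall>t. t \<in> S \<longrightarrow> t \<noteq> x \<longrightarrow> \<bar>t - x\<bar> < d \<longrightarrow> \<bar>f t\<bar> \<le> \<bar>l\<bar> + 1"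
      if "(f \<longlongrightarrow> l) (at x within S)" for l S
    proof -
      have "\<forall>\<^sub>F t in at x within S. dist (f t) l < 1"
        using that by (rule tendstoD) simp
      then obtain d where "d > 0" "\<And>t. t \<in> S \<Longrightarrow> t \<noteq> x \<Longrightarrow> dist t x < d \<Longrightarrow> dist (f t) l < 1"
        unfolding eventually_at by blast
      then show ?thesis
        by (intro exI[of _ d]) (force simp: dist_real_def)
    qed
    obtain d1 where d1: "d1 > 0" "\<And>t. x < t \<Longrightarrow> \<bar>t - x\<bar> < d1 \<Longrightarrow> \<bar>f t\<bar> \<le> \<bar>f x\<bar> + 1"
      using lim[of "f x" "{x<..}"] assms x unfolding cadlag_def by force
    have "\<exists>l. \<exists>d2>0. \<forall>t. 0 \<le> t \<longrightarrow> t < x \<longrightarrow> \<bar>t - x\<bar> < d2 \<longrightarrow> \<bar>f t\<bar> \<le> \<bar>l\<bar> + 1"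
    proof (cases "x = 0")
      case True
      then show ?thesis by (intro exI[of _ 0] exI[of _ 1]) auto
    next
      case False
      then obtain l where "(f \<longlongrightarrow> l) (at_left x)" using assms x unfolding cadlag_def by force
      then obtain d where "d > 0" "\<And>t. t < x \<Longrightarrow> \<bar>t - x\<bar> < d \<Longrightarrow> \<bar>f t\<bar> \<le> \<bar>l\<bar> + 1"
        using lim[of l "{..<x}"] by force
      then show ?thesis by blast
    qed
    then obtain l d2 where d2: "d2 > 0" "\<And>t. 0 \<le> t \<Longrightarrow> t < x \<Longrightarrow> \<bar>t - x\<bar> < d2 \<Longrightarrow> \<bar>f t\<bar> \<le> \<bar>l\<bar> + 1"
      by blast
    show "\<exists>d>0. \<forall>a b. a \<le> x \<and> x \<le> b \<and> b - a < d \<longrightarrow> P a b"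
    proof (intro exI[of _ "min d1 d2"] conjI allI impI)
      fix a b assume ab: "a \<le> x \<and> x \<le> b \<and> b - a < min d1 d2"
      have "\<bar>f t\<bar> \<le> \<bar>f x\<bar> + \<bar>l\<bar> + 1" if "t \<in> {a..b} \<inter> {0..T}" for t
        using d1(2)[of t] d2(2)[of t] that ab by (cases t x rule: linorder_cases) force+
      then show "P a b" unfolding P_def by blast
    qed (use d1 d2 in auto)
  qed
  then show ?thesis by (auto simp: P_def)
qed auto

text \<open>The dyadic approximations lie strictly to the right of \<open>t\<close>, so right-continuity applies.\<close>

lemma cadlag_dyadic_limit:
  assumes "cadlag f" "0 \<le> t"
  shows "(\<lambda>m. f ((real_of_int \<lfloor>2 ^ m * t\<rfloor> + 1) / 2 ^ m)) \<longlonglongrightarrow> f t"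
proof -
  define s where "s m = (real_of_int \<lfloor>2 ^ m * t\<rfloor> + 1) / 2 ^ m" for m :: nat
  have s: "t < s m" "s m \<le> t + (1 / 2) ^ m" for m
  proof -
    have "2 ^ m * t < real_of_int \<lfloor>2 ^ m * t\<rfloor> + 1" "real_of_int \<lfloor>2 ^ m * t\<rfloor> \<le> 2 ^ m * t"
      by linarith+
    then show "t < s m" "s m \<le> t + (1 / 2) ^ m"
      by (simp_all add: s_def field_simps power_divide)
  qed
  have "s \<longlonglongrightarrow> t"
  proof (rule tendsto_sandwich[OF _ _ tendsto_const])
    show "(\<lambda>m. t + (1 / 2) ^ m) \<longlonglongrightarrow> t"
      by (rule tendsto_eq_intros LIMSEQ_power_zero | simp)+
  qed (use s in \<open>auto intro!: always_eventually less_imp_le\<close>)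
  then have "filterlim s (at_right t) sequentially"
    using s by (auto simp: filterlim_at intro: always_eventually)
  moreover have "(f \<longlongrightarrow> f t) (at_right t)" using assms by (auto simp: cadlag_def)
  ultimately show ?thesis using filterlim_compose unfolding s_def by blast
qed

lemma cadlag_measurable:
  assumes "cadlag f"
  shows "(\<lambda>t. indicator {0..} t * f t) \<in> borel_measurable borel"
proof (rule borel_measurable_LIMSEQ_real)
  fix t :: real
  show "(\<lambda>m. indicator {0..} t * f ((real_of_int \<lfloor>2 ^ m * t\<rfloor> + 1) / 2 ^ m)) \<longlonglongrightarrow> indicator {0..} t * f t"
    using cadlag_dyadic_limit[OF assms, of t] by (cases "0 \<le> t") auto
next
  fix m :: nat
  have "(\<lambda>t::real. \<lfloor>2 ^ m * t\<rfloor>) \<in> borel \<rightarrow>\<^sub>M count_space (UNIV :: int set)" for m :: nat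
    by measurable
  from measurable_compose[OF this, of "\<lambda>i. f ((real_of_int i + 1) / 2 ^ _)" borel _]
  have [measurable]: "(\<lambda>t::real. f ((real_of_int \<lfloor>2 ^ m * t\<rfloor> + 1) / 2 ^ m)) \<in> borel_measurable borel" for m :: nat
    by simp
  show "(\<lambda>t::real. indicator {0..} t * f ((real_of_int \<lfloor>2 ^ m * t\<rfloor> + 1) / 2 ^ m)) \<in> borel_measurable borel"
    by measurable
qed

lemma cadlag_dyadic_bound:
  assumes f: "cadlag f"
    and b: "\<And>m i. i \<le> (2::nat) ^ m \<Longrightarrow> \<bar>f (real j + real i / 2 ^ m) - f (real j)\<bar> \<le> b"
    and t: "real j \<le> t" "t \<le> real j + 1"
  shows "\<bar>f t - f (real j)\<bar> \<le> b"
proof (cases "t = real j + 1")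
  case True
  then show ?thesis using b[of 1 0] by simp
next
  case False
  have "\<bar>f ((real_of_int \<lfloor>2 ^ m * t\<rfloor> + 1) / 2 ^ m) - f (real j)\<bar> \<le> b" for m :: nat
  proof -
    define i where "i = nat (\<lfloor>2 ^ m * t\<rfloor> + 1 - 2 ^ m * int j)"
    have "2 ^ m * int j \<le> \<lfloor>2 ^ m * t\<rfloor>" using t by (simp add: le_floor_iff)
    moreover have "\<lfloor>2 ^ m * t\<rfloor> < 2 ^ m * (int j + 1)"
      using t False by (simp add: floor_less_iff)
    ultimately have i: "i \<le> 2 ^ m" "int i = \<lfloor>2 ^ m * t\<rfloor> + 1 - 2 ^ m * int j"
      by (auto simp: i_def algebra_simps)
    have "real i = real_of_int \<lfloor>2 ^ m * t\<rfloor> + 1 - 2 ^ m * real j"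
      using arg_cong[OF i(2), of real_of_int] by simp
    then have "real j + real i / 2 ^ m = (real_of_int \<lfloor>2 ^ m * t\<rfloor> + 1) / 2 ^ m"
      by (simp add: field_simps)
    then show ?thesis using b[OF i(1)] by simp
  qed
  moreover have "(\<lambda>m. \<bar>f ((real_of_int \<lfloor>2 ^ m * t\<rfloor> + 1) / 2 ^ m) - f (real j)\<bar>) \<longlonglongrightarrow> \<bar>f t - f (real j)\<bar>"
    using t by (intro tendsto_intros cadlag_dyadic_limit f) auto
  ultimately show ?thesis by (auto intro: LIMSEQ_le_const2)
qed

text \<open>Up to time \<open>J\<close> the path is bounded because it is cadlag; afterwards at most \<open>n\<close> increments of size
\<open>2 * n ^ p\<close> have accumulated at time \<open>n\<close>.\<close>

lemma polynomial_growth_of_increments: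
  assumes f: "cadlag f"
    and inc: "\<And>j t. J \<le> j \<Longrightarrow> real j \<le> t \<Longrightarrow> t \<le> real j + 1 \<Longrightarrow> \<bar>f t - f (real j)\<bar> \<le> 2 * real j ^ p"
  shows "\<exists>C N. \<forall>t\<ge>0. \<bar>f t\<bar> \<le> C * (1 + t ^ N)"
proof -
  obtain B where B: "\<And>t. 0 \<le> t \<Longrightarrow> t \<le> real J \<Longrightarrow> \<bar>f t\<bar> \<le> B"
    using cadlag_bounded[OF f, of "real J"] by (meson atLeastAtMost_iff)
  have B0: "0 \<le> B" using B[of 0] by simp
  have n: "\<bar>f (real n)\<bar> \<le> B + 2 * real n ^ (p + 1)" if "J \<le> n" for n
    using that
  proof (induction n rule: dec_induct)
    case base
    then show ?case using B[of "real J"] by (simp add: add_increasing2)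
  next
    case (step n)
    have "\<bar>f (real (Suc n))\<bar> \<le> \<bar>f (real n)\<bar> + 2 * real n ^ p"
      using inc[of n "real (Suc n)"] step by simp
    also have "\<dots> \<le> B + 2 * (real n ^ p * (real n + 1))" using step by (simp add: algebra_simps)
    also have "\<dots> \<le> B + 2 * (real (Suc n) ^ p * (real n + 1))"
      by (intro add_left_mono mult_left_mono mult_right_mono power_mono) auto
    finally show ?case by (simp add: algebra_simps)
  qed
  have "\<bar>f t\<bar> \<le> (B + 4) * (1 + t ^ (p + 1))" if t: "0 \<le> t" for t
  proof -
    have t0: "0 \<le> t ^ (p + 1)" using t by simp
    have "\<bar>f t\<bar> \<le> B + 4 * (1 + t ^ (p + 1))"
    proof (cases "t \<le> real J")
      case True
      then have "\<bar>f t\<bar> \<le> B" by (rule B[OF t])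
      then show ?thesis using t0 by simp
    next
      case False
      define k where "k = nat \<lfloor>t\<rfloor>"
      have k: "real k \<le> t" "t \<le> real k + 1" "J \<le> k"
        using t False by (auto simp: k_def le_nat_iff le_floor_iff)
      have "t ^ p \<le> 1 + t ^ (p + 1)"
      proof (cases "t \<le> 1")
        case True then show ?thesis using power_le_one[OF t True, of p] t0 by linarith
      next
        case False
        then have "t ^ p \<le> t ^ (p + 1)" by (intro power_increasing) auto
        then show ?thesis by simp
      qed
      have "\<bar>f t\<bar> \<le> \<bar>f (real k)\<bar> + 2 * real k ^ p" using inc[OF k(3,1,2)] by linarith
      also have "\<dots> \<le> B + 2 * real k ^ (p + 1) + 2 * real k ^ p" using n[OF k(3)] by simp
      also have "\<dots> \<le> B + 2 * t ^ (p + 1) + 2 * t ^ p"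
        using k by (intro add_mono mult_left_mono power_mono) auto
      also have "\<dots> \<le> B + 4 * (1 + t ^ (p + 1))"
      proof -
        have "B + 2 * v + 2 * u \<le> B + 4 * (1 + v)" if "u \<le> 1 + v" "0 \<le> v" for u v :: real
          using that by (simp add: distrib_left)
        then show ?thesis using \<open>t ^ p \<le> 1 + t ^ (p + 1)\<close> t0 by blast
      qed
      finally show ?thesis .
    qed
    also have "\<dots> \<le> (B + 4) * (1 + t ^ (p + 1))"
      using B0 t0 mult_left_mono[of 1 "1 + t ^ (p + 1)" B] by (simp add: algebra_simps)
    finally show ?thesis .
  qed
  then show ?thesis by blast
qed

section \<open>A maximal inequality and independence of blocks\<close>

text \<open>Decompose according to the first index \<open>i\<close> at which the partial sum exceeds \<open>2 * a\<close>. This event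
depends on the summands before \<open>i\<close> only, so it is independent of the remaining sum, which is at most
\<open>a\<close> with probability at least one half; when both occur, the total sum exceeds \<open>a\<close>.\<close>

lemma (in prob_space) ottaviani_inequality:
  fixes D :: "nat \<Rightarrow> 'a \<Rightarrow> real"
  assumes ind: "indep_vars (\<lambda>_. borel) D {..<n}"
    and tail: "\<And>i. i \<le> n \<Longrightarrow> prob {\<omega> \<in> space M. a < \<bar>\<Sum>l\<in>{i..<n}. D l \<omega>\<bar>} \<le> 1 / 2"
  shows "prob {\<omega> \<in> space M. \<exists>i\<le>n. 2 * a < \<bar>\<Sum>l<i. D l \<omega>\<bar>} \<le>
    2 * prob {\<omega> \<in> space M. a < \<bar>\<Sum>l<n. D l \<omega>\<bar>}"
proof -
  have rv: "D l \<in> borel_measurable M" if "l < n" for l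
    using ind that by (auto simp: indep_vars_def)
  define S where "S i \<omega> = (\<Sum>l<i. D l \<omega>)" for i \<omega>
  define R where "R i \<omega> = (\<Sum>l\<in>{i..<n}. D l \<omega>)" for i \<omega>
  have S_rv: "S i \<in> borel_measurable M" if "i \<le> n" for i
    unfolding S_def[abs_def] using that by (intro borel_measurable_sum rv) auto
  have R_rv: "R i \<in> borel_measurable M" for i
    unfolding R_def[abs_def] by (intro borel_measurable_sum rv) auto
  have SR: "S n \<omega> = S i \<omega> + R i \<omega>" if "i \<le> n" for i \<omega>
    unfolding S_def R_def using that sum.atLeastLessThan_concat[of 0 i n "\<lambda>l. D l \<omega>"]
    by (simp add: atLeast0LessThan)
  define B where "B i = {\<omega> \<in> space M. 2 * a < \<bar>S i \<omega>\<bar> \<and> (\<forall>i'\<in>{..<i}. \<bar>S i' \<omega>\<bar> \<le> 2 * a)}" for i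
  define G where "G i = {\<omega> \<in> space M. \<bar>R i \<omega>\<bar> \<le> a}" for i
  have G[measurable]: "G i \<in> events" for i unfolding G_def using R_rv by measurable
  have B: "B i \<in> events" if "i \<le> n" for i
    unfolding B_def using that
    by (intro sets.sets_Collect_conj sets.sets_Collect_finite_All borel_measurable_less borel_measurable_le
        borel_measurable_abs S_rv) auto
  have ind_BG: "prob (B i \<inter> G i) = prob (B i) * prob (G i)" if i: "i \<le> n" for i
  proof -
    let ?P = "PiM {..<i} (\<lambda>_. borel) :: (nat \<Rightarrow> real) measure"
    let ?Q = "PiM {i..<n} (\<lambda>_. borel) :: (nat \<Rightarrow> real) measure"
    let ?f = "\<lambda>\<omega>. restrict (\<lambda>l. D l \<omega>) {..<i}"
    let ?g = "\<lambda>\<omega>. restrict (\<lambda>l. D l \<omega>) {i..<n}"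
    have iv: "indep_var ?P ?f ?Q ?g"
      by (rule indep_var_restrict[OF ind]) (use i in auto)
    define Ba where "Ba = {f \<in> space ?P. 2 * a < \<bar>\<Sum>l<i. f l\<bar> \<and> (\<forall>i'\<in>{..<i}. \<bar>\<Sum>l<i'. f l\<bar> \<le> 2 * a)}"
    define Ga where "Ga = {f \<in> space ?Q. \<bar>\<Sum>l\<in>{i..<n}. f l\<bar> \<le> a}"
    have "(\<lambda>f. \<Sum>l<i'. f l) \<in> borel_measurable ?P" if "i' \<le> i" for i'
      using that by (intro borel_measurable_sum measurable_component_singleton) auto
    then have Ba: "Ba \<in> sets ?P" unfolding Ba_def
      by (intro sets.sets_Collect_conj sets.sets_Collect_finite_All borel_measurable_less borel_measurable_le
          borel_measurable_abs) auto
    have "(\<lambda>f. \<Sum>l\<in>{i..<n}. f l) \<in> borel_measurable ?Q"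
      by (intro borel_measurable_sum measurable_component_singleton) auto
    then have Ga: "Ga \<in> sets ?Q" unfolding Ga_def by measurable
    have fB: "?f -` Ba \<inter> space M = B i" unfolding Ba_def B_def S_def
      by (auto simp: space_PiM)
    have gG: "?g -` Ga \<inter> space M = G i" unfolding Ga_def G_def R_def
      by (auto simp: space_PiM)
    have "(\<lambda>x. (?f x, ?g x)) -` (Ba \<times> Ga) \<inter> space M = B i \<inter> G i"
      using fB gG by auto
    then show ?thesis using indep_varD[OF iv Ba Ga] by (simp add: fB gG)
  qed
  have G_half: "1 / 2 \<le> prob (G i)" if "i \<le> n" for i
  proof -
    have "{\<omega> \<in> space M. a < \<bar>R i \<omega>\<bar>} = space M - G i" by (auto simp: G_def)
    then show ?thesis using tail[OF that] prob_compl[OF G, of i] by (simp add: R_def)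
  qed
  have disj: "disjoint_family_on B {..n}"
  unfolding disjoint_family_on_def
  proof (intro ballI impI)
    have "B i \<inter> B k = {}" if "i < k" for i k
    proof -
      have "2 * a < \<bar>S i \<omega>\<bar>" if "\<omega> \<in> B i" for \<omega> using that by (simp add: B_def)
      moreover have "\<bar>S i \<omega>\<bar> \<le> 2 * a" if "\<omega> \<in> B k" for \<omega>
        using that \<open>i < k\<close> by (simp add: B_def)
      ultimately show ?thesis by force
    qed
    then show "B i \<inter> B k = {}" if "i \<noteq> k" for i k
      using that by (cases i k rule: linorder_cases) blast+
  qed
  have "{\<omega> \<in> space M. \<exists>i\<le>n. 2 * a < \<bar>S i \<omega>\<bar>} \<subseteq> (\<Union>i\<le>n. B i)"
  proof safe
    fix \<omega> i assume \<omega>: "\<omega> \<in> space M" "i \<le> n" "2 * a < \<bar>S i \<omega>\<bar>"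
    define k where "k = (LEAST k. 2 * a < \<bar>S k \<omega>\<bar>)"
    have "2 * a < \<bar>S k \<omega>\<bar>" unfolding k_def using \<omega>(3) by (rule LeastI)
    moreover have "k \<le> i" unfolding k_def using \<omega>(3) by (rule Least_le)
    moreover have "\<bar>S i' \<omega>\<bar> \<le> 2 * a" if "i' < k" for i'
      using not_less_Least[of i' "\<lambda>k. 2 * a < \<bar>S k \<omega>\<bar>"] that by (simp add: k_def)
    ultimately show "\<omega> \<in> (\<Union>i\<le>n. B i)" using \<omega> by (auto simp: B_def intro!: bexI[of _ k])
  qed
  then have "prob {\<omega> \<in> space M. \<exists>i\<le>n. 2 * a < \<bar>S i \<omega>\<bar>} \<le> prob (\<Union>i\<le>n. B i)"
    using B by (intro finite_measure_mono) auto
  also have "\<dots> = (\<Sum>i\<le>n. prob (B i))"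
    using B disj by (intro finite_measure_finite_Union) auto
  also have "\<dots> \<le> (\<Sum>i\<le>n. 2 * prob (B i \<inter> G i))"
  proof (rule sum_mono)
    fix i assume "i \<in> {..n}"
    then show "prob (B i) \<le> 2 * prob (B i \<inter> G i)"
      using ind_BG[of i] G_half[of i] mult_left_mono[of "1 / 2" "prob (G i)" "prob (B i)"] by simp
  qed
  also have "\<dots> = 2 * prob (\<Union>i\<le>n. B i \<inter> G i)"
    using B disj unfolding sum_distrib_left[symmetric]
    by (subst finite_measure_finite_Union) (auto simp: disjoint_family_on_def)
  also have "prob (\<Union>i\<le>n. B i \<inter> G i) \<le> prob {\<omega> \<in> space M. a < \<bar>S n \<omega>\<bar>}"
  proof (rule finite_measure_mono)
    show "(\<Union>i\<le>n. B i \<inter> G i) \<subseteq> {\<omega> \<in> space M. a < \<bar>S n \<omega>\<bar>}"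
    proof safe
      fix \<omega> i assume "i \<le> n" "\<omega> \<in> B i" "\<omega> \<in> G i"
      then show "a < \<bar>S n \<omega>\<bar>" using SR[of i \<omega>] by (auto simp: B_def G_def)
    qed (auto simp: B_def)
    show "{\<omega> \<in> space M. a < \<bar>S n \<omega>\<bar>} \<in> events" using S_rv[of n] by measurable
  qed
  finally show ?thesis by (simp add: S_def)
qed

lemma (in prob_space) decreasing_events_tendsto_0:
  assumes "\<And>k. A k \<in> events" "decseq A" "AE \<omega> in M. \<exists>k. \<omega> \<notin> A k"
  shows "(\<lambda>k. prob (A k)) \<longlonglongrightarrow> 0"
proof -
  have "(\<lambda>k. prob (A k)) \<longlonglongrightarrow> prob (\<Inter>k. A k)"
    using assms by (intro finite_Lim_measure_decseq) auto
  moreover have "prob (\<Inter>k. A k) = 0"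
    using assms by (subst prob_eq_0) (auto elim: eventually_mono)
  ultimately show ?thesis by simp
qed

lemma (in prob_space) prob_no_triple:
  fixes G :: "nat \<Rightarrow> 'a set"
  assumes G: "indep_events G {..<3 * K}" and J: "J \<subseteq> {..<K}" "J \<noteq> {}"
  shows "prob (\<Inter>k\<in>J. space M - G (3 * k) \<inter> G (3 * k + 1) \<inter> G (3 * k + 2)) =
    (\<Prod>k\<in>J. 1 - prob (G (3 * k)) * prob (G (3 * k + 1)) * prob (G (3 * k + 2)))"
proof -
  let ?T = "\<lambda>k. {3 * k, 3 * k + 1, 3 * k + 2 :: nat}"
  let ?E = "\<lambda>k. G (3 * k) \<inter> G (3 * k + 1) \<inter> G (3 * k + 2)"
  let ?\<Sigma> = "\<lambda>k. sigma_sets (space M) (\<Union>i\<in>?T k. {G i})"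
  have ev: "G i \<in> events" if "i < 3 * K" for i using G that by (auto simp: indep_events_def)
  have "indep_sets (\<lambda>i. {G i}) (\<Union>k\<in>{..<K}. ?T k)"
    by (rule indep_sets_mono_index[OF _ G[unfolded indep_events_def_alt]]) auto
  then have ind: "indep_sets ?\<Sigma> {..<K}"
  proof (rule indep_sets_collect_sigma)
    have quotient: "i div 3 = k" if "i \<in> ?T k" for i k using that by auto
    show "disjoint_family_on ?T {..<K}"
      unfolding disjoint_family_on_def
    proof (intro ballI impI Int_emptyI)
      fix k k' i assume "k \<noteq> k'" "i \<in> ?T k" "i \<in> ?T k'"
      from this(1) quotient[OF this(2)] quotient[OF this(3)] show False by simp
    qed
  qed (auto simp: Int_stable_def)
  have mem: "space M - ?E k \<in> ?\<Sigma> k" if "k < K" for k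
  proof -
    have "(\<Union>i\<in>?T k. {G i}) \<subseteq> Pow (space M)"
      using that sets.sets_into_space[OF ev] by auto
    then interpret S: sigma_algebra "space M" "?\<Sigma> k" by (rule sigma_algebra_sigma_sets)
    have "G i \<in> ?\<Sigma> k" if "i \<in> ?T k" for i using that by (intro sigma_sets.Basic) auto
    then show ?thesis by (intro S.compl_sets S.Int) auto
  qed
  have p: "prob (space M - ?E k) = 1 - prob (G (3 * k)) * prob (G (3 * k + 1)) * prob (G (3 * k + 2))"
    if "k < K" for k
  proof -
    have "prob (\<Inter>i\<in>?T k. G i) = (\<Prod>i\<in>?T k. prob (G i))"
      using G that unfolding indep_events_def by (elim conjE allE[of _ "?T k"]) auto
    moreover have "(\<Inter>i\<in>?T k. G i) = ?E k" by auto
    ultimately have "prob (?E k) = prob (G (3 * k)) * prob (G (3 * k + 1)) * prob (G (3 * k + 2))" by simp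
    then show ?thesis using that ev by (subst prob_compl) auto
  qed
  have "prob (\<Inter>k\<in>J. space M - ?E k) = (\<Prod>k\<in>J. prob (space M - ?E k))"
    using J mem by (intro indep_setsD[OF ind]) (auto intro: finite_subset)
  also have "\<dots> = (\<Prod>k\<in>J. 1 - prob (G (3 * k)) * prob (G (3 * k + 1)) * prob (G (3 * k + 2)))"
    using J p by (intro prod.cong) auto
  finally show ?thesis .
qed

lemma (in prob_space) tail_prob_tendsto_0:
  assumes "Y \<in> borel_measurable M"
  shows "(\<lambda>k. prob {\<omega> \<in> space M. real k < \<bar>Y \<omega>\<bar>}) \<longlonglongrightarrow> 0"
proof (rule decreasing_events_tendsto_0)
  show "decseq (\<lambda>k. {\<omega> \<in> space M. real k < \<bar>Y \<omega>\<bar>})"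
    by (auto simp: decseq_def)
  show "AE \<omega> in M. \<exists>k. \<omega> \<notin> {\<omega> \<in> space M. real k < \<bar>Y \<omega>\<bar>}"
  proof (rule AE_I2)
    fix \<omega> obtain k where "\<bar>Y \<omega>\<bar> \<le> real k" using real_arch_simple by blast
    then show "\<exists>k. \<omega> \<notin> {\<omega> \<in> space M. real k < \<bar>Y \<omega>\<bar>}" by (auto simp: not_less)
  qed
qed (use assms in measurable)

section \<open>Oscillation of a Levy process over unit intervals\<close>

context levy_process
begin

text \<open>The path is seen on the grid of mesh \<open>1 / 2 ^ m\<close> here, and at all dyadic times in the definition that
follows. Countably many times keep the events
measurable, and right-continuity recovers the remaining ones.\<close>

definition oscillates_at :: "nat \<Rightarrow> nat \<Rightarrow> real \<Rightarrow> 'w set" where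
  "oscillates_at m j b =
     {\<omega> \<in> space M. \<exists>i\<le>2 ^ m. b < \<bar>X (real j + real i / 2 ^ m) \<omega> - X (real j) \<omega>\<bar>}"

definition oscillates :: "nat \<Rightarrow> real \<Rightarrow> 'w set" where
  "oscillates j b = (\<Union>m. oscillates_at m j b)"

lemma compl_oscillates_at:
  "space M - oscillates_at m j b =
     {\<omega> \<in> space M. \<forall>i\<in>{..2 ^ m}. \<bar>X (real j + real i / 2 ^ m) \<omega> - X (real j) \<omega>\<bar> \<le> b}"
  by (rule set_eqI) (simp add: oscillates_at_def not_less Ball_def cong: conj_cong)

lemma oscillates_at_measurable [measurable]: "oscillates_at m j b \<in> events"
proof -
  have "oscillates_at m j b =
      {\<omega> \<in> space M. \<exists>i\<in>{..2 ^ m}. b < \<bar>X (real j + real i / 2 ^ m) \<omega> - X (real j) \<omega>\<bar>}"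
    by (auto simp: oscillates_at_def)
  also have "\<dots> \<in> events"
    by (intro sets.sets_Collect_finite_Ex borel_measurable_less borel_measurable_abs
        borel_measurable_diff random_variable_X) auto
  finally show ?thesis .
qed

lemma oscillates_measurable [measurable]: "oscillates j b \<in> events"
  unfolding oscillates_def by measurable

lemma incseq_oscillates_at: "incseq (\<lambda>m. oscillates_at m j b)"
proof (rule incseq_SucI, rule subsetI)
  fix m \<omega> assume "\<omega> \<in> oscillates_at m j b"
  then obtain i where i: "\<omega> \<in> space M" "i \<le> 2 ^ m" "b < \<bar>X (real j + real i / 2 ^ m) \<omega> - X (real j) \<omega>\<bar>"
    by (auto simp: oscillates_at_def)
  have "real (2 * i) / 2 ^ Suc m = real i / 2 ^ m" by simp
  then show "\<omega> \<in> oscillates_at (Suc m) j b"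
    unfolding oscillates_at_def using i
    by (intro CollectI conjI exI[of _ "2 * i"]) (simp_all only:, simp_all)
qed

lemma prob_increment:
  assumes "0 \<le> s" "0 \<le> h"
  shows "prob {\<omega> \<in> space M. a < \<bar>X (s + h) \<omega> - X s \<omega>\<bar>} = prob {\<omega> \<in> space M. a < \<bar>X h \<omega> - X 0 \<omega>\<bar>}"
proof -
  have *: "measure (distr M borel Y) {x. a < \<bar>x\<bar>} = prob {\<omega> \<in> space M. a < \<bar>Y \<omega>\<bar>}"
    if "Y \<in> borel_measurable M" for Y
    using that by (subst measure_distr) (auto intro!: arg_cong[where f = prob])
  have "(\<lambda>\<omega>. X (s + h) \<omega> - X s \<omega>) \<in> borel_measurable M" "(\<lambda>\<omega>. X h \<omega> - X 0 \<omega>) \<in> borel_measurable M"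
    using assms by (auto intro!: borel_measurable_diff random_variable_X)
  from this[THEN *] show ?thesis using stationary_increments[OF assms] by simp
qed

lemma prob_unit_increment:
  "prob {\<omega> \<in> space M. a < \<bar>X (real j + 1) \<omega> - X (real j) \<omega>\<bar>} = prob {\<omega> \<in> space M. a < \<bar>X 1 \<omega>\<bar>}"
proof -
  have rv: "X 0 \<in> borel_measurable M" "X 1 \<in> borel_measurable M" by (auto intro: random_variable_X)
  have "prob {\<omega> \<in> space M. a < \<bar>X 1 \<omega> - X 0 \<omega>\<bar>} = prob {\<omega> \<in> space M. a < \<bar>X 1 \<omega>\<bar>}"
    using start_zero rv by (intro measure_eq_AE) (auto elim!: eventually_mono)
  then show ?thesis by (simp add: prob_increment)
qed

lemma grid_telescope:
  assumes "a \<le> b"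
  shows "(\<Sum>l\<in>{a..<b}. X (s + real (Suc l) / 2 ^ m) \<omega> - X (s + real l / 2 ^ m) \<omega>) =
    X (s + real b / 2 ^ m) \<omega> - X (s + real a / 2 ^ m) \<omega>"
  using sum_Suc_diff'[OF assms, of "\<lambda>l. X (s + real l / 2 ^ m) \<omega>"] .

lemma grid_increments_independent:
  "0 \<le> s \<Longrightarrow> indep_vars (\<lambda>_. borel)
    (\<lambda>l \<omega>. X (s + real (Suc l) / 2 ^ m) \<omega> - X (s + real l / 2 ^ m) \<omega>) {..<n}"
  by (intro independent_increments) (auto simp: divide_strict_right_mono)

text \<open>On a fixed grid both kinds of events are determined by the increments inside one unit interval, and
these blocks of increments are disjoint. The passage to all dyadic times is made on probabilities, in
\<open>quiet_jump_quiet_infinitely_often\<close>.\<close>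

lemma quiet_or_jump_independent:
  shows "indep_events (\<lambda>j. if j mod 3 = 1
      then {\<omega> \<in> space M. c (j div 3) < \<bar>X (real j + 1) \<omega> - X (real j) \<omega>\<bar>}
      else space M - oscillates_at m j b) {..<L}"
proof -
  let ?K = "\<lambda>j. {j * 2 ^ m..<(j + 1) * 2 ^ m}"
  let ?D = "\<lambda>l \<omega>. X (0 + real (Suc l) / 2 ^ m) \<omega> - X (0 + real l / 2 ^ m) \<omega>"
  let ?Q = "\<lambda>j. PiM (?K j) (\<lambda>_. borel) :: (nat \<Rightarrow> real) measure"
  define P where "P j f \<longleftrightarrow> (if j mod 3 = 1 then c (j div 3) < \<bar>\<Sum>l\<in>?K j. f l\<bar>
    else \<forall>i\<in>{..2 ^ m}. \<bar>\<Sum>l\<in>{j * 2 ^ m..<j * 2 ^ m + i}. f l\<bar> \<le> b)" for j and f :: "nat \<Rightarrow> real"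
  have "disjoint_family_on ?K {..<L}"
  unfolding disjoint_family_on_def
  proof (intro ballI impI)
    fix i j :: nat assume "i \<noteq> j"
    have "l div 2 ^ m = j" if "l \<in> ?K j" for l j :: nat
      using that by (auto intro!: div_nat_eqI simp: mult.commute)
    then show "?K i \<inter> ?K j = {}" using \<open>i \<noteq> j\<close> by blast
  qed
  moreover have "?K j \<subseteq> {..<L * 2 ^ m}" if "j \<in> {..<L}" for j
  proof -
    have "(j + 1) * 2 ^ m \<le> L * 2 ^ m" using that by (intro mult_right_mono) auto
    then show ?thesis by auto
  qed
  ultimately have "indep_vars ?Q (\<lambda>j \<omega>. restrict (\<lambda>l. ?D l \<omega>) (?K j)) {..<L}"
    by (intro indep_vars_restrict[OF grid_increments_independent[of 0 m "L * 2 ^ m"]]) auto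
  moreover have "{f \<in> space (?Q j). P j f} \<in> sets (?Q j)" for j
  proof -
    have sm: "(\<lambda>f. \<Sum>l\<in>A. f l) \<in> borel_measurable (?Q j)" if "A \<subseteq> ?K j" for A
      using that by (intro borel_measurable_sum measurable_component_singleton) auto
    show ?thesis
    proof (cases "j mod 3 = 1")
      case True
      then show ?thesis using sm[of "?K j"] unfolding P_def by simp
    next
      case False
      then show ?thesis unfolding P_def
        by (simp only: if_False) (intro sets.sets_Collect_finite_All borel_measurable_le borel_measurable_abs sm, auto)
    qed
  qed
  ultimately have "indep_events (\<lambda>j. {\<omega> \<in> space M. P j (restrict (\<lambda>l. ?D l \<omega>) (?K j))}) {..<L}"
    by (rule indep_eventsI_indep_vars)
  moreover have "{\<omega> \<in> space M. P j (restrict (\<lambda>l. ?D l \<omega>) (?K j))} = (if j mod 3 = 1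
      then {\<omega> \<in> space M. c (j div 3) < \<bar>X (real j + 1) \<omega> - X (real j) \<omega>\<bar>}
      else space M - oscillates_at m j b)" for j
  proof -
    have pos: "real (j * 2 ^ m + i) / 2 ^ m = real j + real i / 2 ^ m" for i
      by (simp add: add_divide_distrib)
    have sub: "(\<Sum>l\<in>{j * 2 ^ m..<j * 2 ^ m + i}. restrict (\<lambda>l. ?D l \<omega>) (?K j) l) =
        X (real j + real i / 2 ^ m) \<omega> - X (real j) \<omega>" if "i \<le> 2 ^ m" for i \<omega>
    proof -
      have "(\<Sum>l\<in>{j * 2 ^ m..<j * 2 ^ m + i}. restrict (\<lambda>l. ?D l \<omega>) (?K j) l) =
          (\<Sum>l\<in>{j * 2 ^ m..<j * 2 ^ m + i}. ?D l \<omega>)"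
        using that by (intro sum.cong) auto
      also have "\<dots> = X (0 + real (j * 2 ^ m + i) / 2 ^ m) \<omega> - X (0 + real (j * 2 ^ m) / 2 ^ m) \<omega>"
        by (rule grid_telescope) simp
      finally show ?thesis using pos[of i] pos[of 0] by (simp only: add_0 add_0_right) simp
    qed
    have full: "?K j = {j * 2 ^ m..<j * 2 ^ m + 2 ^ m}" by (simp add: algebra_simps)
    have all: "(\<Sum>l\<in>?K j. restrict (\<lambda>l. ?D l \<omega>) (?K j) l) = X (real j + 1) \<omega> - X (real j) \<omega>" for \<omega>
      using sub[of "2 ^ m" \<omega>] unfolding full by simp
    show ?thesis
    proof (cases "j mod 3 = 1")
      case True
      then show ?thesis by (simp only: P_def all if_True simp_thms)
    next
      case False
      have "P j (restrict (\<lambda>l. ?D l \<omega>) (?K j)) \<longleftrightarrow>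
          (\<forall>i\<in>{..2 ^ m}. \<bar>X (real j + real i / 2 ^ m) \<omega> - X (real j) \<omega>\<bar> \<le> b)" for \<omega>
        unfolding P_def if_not_P[OF False]
        by (intro ball_cong refl) (simp only: sub atMost_iff)
      then show ?thesis by (simp only: if_not_P[OF False] compl_oscillates_at)
    qed
  qed
  ultimately show ?thesis by simp
qed

text \<open>A second Borel-Cantelli lemma for triples of unit intervals. On the grid of mesh \<open>1 / 2 ^ m\<close> the
triples are independent and the \<open>k\<close>-th one succeeds with probability at least a quarter of the
\<open>k\<close>-th term of the divergent series, whatever \<open>m\<close> is. The probability that all triples from \<open>k0\<close>
up to \<open>K\<close> fail is thus bounded by an exponential that does not depend on \<open>m\<close>, and tends to 0 with
growing \<open>K\<close>. Failure for all dyadic times means failure on every sufficiently fine grid, so the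
bound survives the limit in \<open>m\<close>.\<close>

lemma quiet_jump_quiet_infinitely_often:
  assumes quiet: "\<And>j. prob (oscillates j b) \<le> 1 / 2"
    and jump: "\<not> summable (\<lambda>k. prob {\<omega> \<in> space M. c k < \<bar>X 1 \<omega>\<bar>})"
  shows "AE \<omega> in M. \<forall>k0. \<exists>k\<ge>k0. \<omega> \<notin> oscillates (3 * k) b \<and>
    c k < \<bar>X (real (3 * k + 1) + 1) \<omega> - X (real (3 * k + 1)) \<omega>\<bar> \<and> \<omega> \<notin> oscillates (3 * k + 2) b"
  unfolding AE_all_countable
proof
  fix k0 :: nat
  let ?p = "\<lambda>k. prob {\<omega> \<in> space M. c k < \<bar>X 1 \<omega>\<bar>}"
  define G where "G m j = (if j mod 3 = 1
      then {\<omega> \<in> space M. c (j div 3) < \<bar>X (real j + 1) \<omega> - X (real j) \<omega>\<bar>}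
      else space M - oscillates_at m j b)" for m j
  let ?E = "\<lambda>m k. G m (3 * k) \<inter> G m (3 * k + 1) \<inter> G m (3 * k + 2)"
  have G_sets [measurable]: "G m j \<in> events" for m j
  proof -
    have [measurable]: "X (real j) \<in> borel_measurable M" "X (real j + 1) \<in> borel_measurable M"
      by (auto intro: random_variable_X)
    show ?thesis unfolding G_def by simp
  qed
  have G0: "G m (3 * k) = space M - oscillates_at m (3 * k) b" for m k by (simp add: G_def)
  have G1: "G m (3 * k + 1) =
      {\<omega> \<in> space M. c k < \<bar>X (real (3 * k + 1) + 1) \<omega> - X (real (3 * k + 1)) \<omega>\<bar>}" for m k
  proof -
    have "(3 * k + 1) mod 3 = 1" "(3 * k + 1) div 3 = k" by presburger+
    then show ?thesis unfolding G_def by (simp only: if_True simp_thms)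
  qed
  have G2: "G m (3 * k + 2) = space M - oscillates_at m (3 * k + 2) b" for m k
  proof -
    have "(3 * k + 2) mod 3 \<noteq> 1" by presburger
    then show ?thesis unfolding G_def by (simp only: if_False)
  qed
  have half: "1 / 2 \<le> prob (space M - oscillates_at m j b)" for m j
  proof -
    have "prob (oscillates_at m j b) \<le> prob (oscillates j b)"
      by (intro finite_measure_mono) (auto simp: oscillates_def)
    then show ?thesis using quiet[of j] by (subst prob_compl) auto
  qed
  have lower: "?p k / 4 \<le> prob (G m (3 * k)) * prob (G m (3 * k + 1)) * prob (G m (3 * k + 2))" for m k
  proof -
    have "prob (G m (3 * k + 1)) = ?p k" unfolding G1 by (rule prob_unit_increment)
    moreover have "1 / 2 * ?p k * (1 / 2) \<le> prob (G m (3 * k)) * ?p k * prob (G m (3 * k + 2))"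
      using half unfolding G0 G2 by (intro mult_mono) auto
    ultimately show ?thesis by simp
  qed
  define N where "N = {\<omega> \<in> space M. \<forall>k\<in>{k0..}. \<exists>m. \<omega> \<notin> ?E m k}"
  have N_sets: "N \<in> events"
  proof -
    have "N = (\<Inter>k\<in>{k0..}. \<Union>m. space M - ?E m k)" by (auto simp: N_def)
    then show ?thesis by simp
  qed
  have N_bound: "prob N \<le> exp (- (\<Sum>k\<in>{k0..<K}. ?p k) / 4)" if K: "k0 < K" for K
  proof -
    define B where "B m = (\<Inter>k\<in>{k0..<K}. space M - ?E m k)" for m
    have B_sets: "B m \<in> events" for m unfolding B_def using K by (intro sets.finite_INT) auto
    have "prob (B m) \<le> exp (- (\<Sum>k\<in>{k0..<K}. ?p k) / 4)" for m
    proof -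
      have "prob (B m) = (\<Prod>k\<in>{k0..<K}. 1 - prob (G m (3 * k)) * prob (G m (3 * k + 1)) * prob (G m (3 * k + 2)))"
        unfolding B_def using K quiet_or_jump_independent[of c m b "3 * K"]
        by (intro prob_no_triple[of _ K]) (auto simp: G_def[abs_def])
      also have "\<dots> \<le> (\<Prod>k\<in>{k0..<K}. exp (- ?p k / 4))"
      proof (intro prod_mono conjI)
        fix k
        have "prob (G m (3 * k)) * prob (G m (3 * k + 1)) * prob (G m (3 * k + 2)) \<le> 1 * 1 * 1"
          by (intro mult_mono) auto
        then show "0 \<le> 1 - prob (G m (3 * k)) * prob (G m (3 * k + 1)) * prob (G m (3 * k + 2))" by simp
        show "1 - prob (G m (3 * k)) * prob (G m (3 * k + 1)) * prob (G m (3 * k + 2)) \<le> exp (- ?p k / 4)"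
          using lower[of k m] exp_ge_add_one_self[of "- ?p k / 4"] by linarith
      qed
      also have "\<dots> = exp (\<Sum>k\<in>{k0..<K}. - ?p k / 4)" by (simp add: exp_sum)
      also have "(\<Sum>k\<in>{k0..<K}. - ?p k / 4) = - (\<Sum>k\<in>{k0..<K}. ?p k) / 4"
        by (simp add: sum_divide_distrib[symmetric] sum_negf)
      finally show ?thesis .
    qed
    moreover have anti: "?E m' k \<subseteq> ?E m k" if "m \<le> m'" for m m' k
      using that incseqD[OF incseq_oscillates_at] unfolding G0 G1 G2 by blast
    then have "incseq B" unfolding B_def incseq_def by blast
    then have "(\<lambda>m. prob (B m)) \<longlonglongrightarrow> prob (\<Union>m. B m)"
      using B_sets by (intro finite_Lim_measure_incseq) auto
    ultimately have "prob (\<Union>m. B m) \<le> exp (- (\<Sum>k\<in>{k0..<K}. ?p k) / 4)"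
      by (auto intro: LIMSEQ_le_const2)
    moreover have "N \<subseteq> (\<Union>m. B m)"
    proof
      fix \<omega> assume \<omega>: "\<omega> \<in> N"
      then have "\<forall>k. \<exists>m. k0 \<le> k \<longrightarrow> \<omega> \<notin> ?E m k" unfolding N_def by blast
      from choice[OF this] obtain m where m: "\<And>k. k0 \<le> k \<Longrightarrow> \<omega> \<notin> ?E (m k) k" by blast
      \<comment> \<open>The sum of the levels serves as a level that is at least as fine as each of them.\<close>
      have "\<omega> \<notin> ?E (\<Sum>k\<in>{k0..<K}. m k) k" if "k \<in> {k0..<K}" for k
        using m[of k] anti[of "m k" "\<Sum>k\<in>{k0..<K}. m k" k] that member_le_sum[of k "{k0..<K}" m] by auto
      then have "\<omega> \<in> B (\<Sum>k\<in>{k0..<K}. m k)" using \<omega> unfolding B_def N_def by blast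
      then show "\<omega> \<in> (\<Union>m. B m)" by blast
    qed
    ultimately show ?thesis
      using finite_measure_mono[of N "\<Union>m. B m"] B_sets by auto
  qed
  have small: "prob N \<le> exp (- x)" for x
  proof -
    obtain n where n: "4 * \<bar>x\<bar> + real k0 < (\<Sum>k<n. ?p k)"
      using jump summableI_nonneg_bounded[of ?p "4 * \<bar>x\<bar> + real k0"] by (meson measure_nonneg not_le)
    have le: "(\<Sum>k<k0. ?p k) \<le> real k0" using sum_mono[of "{..<k0}" ?p "\<lambda>_. 1"] by simp
    have "k0 < n"
    proof (rule ccontr)
      assume "\<not> k0 < n"
      then have "(\<Sum>k<n. ?p k) \<le> (\<Sum>k<k0. ?p k)" by (intro sum_mono2) auto
      then show False using n le by linarith
    qed
    have "(\<Sum>k<n. ?p k) = (\<Sum>k<k0. ?p k) + (\<Sum>k\<in>{k0..<n}. ?p k)"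
      using \<open>k0 < n\<close> sum.atLeastLessThan_concat[of 0 k0 n ?p] by (simp add: atLeast0LessThan)
    then have "- (\<Sum>k\<in>{k0..<n}. ?p k) / 4 \<le> - x" using n le by linarith
    then show ?thesis using N_bound[OF \<open>k0 < n\<close>] by (meson exp_le_cancel_iff order_trans)
  qed
  have "prob N = 0"
  proof (rule ccontr)
    assume "prob N \<noteq> 0"
    then have pos: "0 < prob N" by (simp add: zero_less_measure_iff)
    have "prob N \<le> exp (ln (prob N) - 1)" using small[of "1 - ln (prob N)"] by simp
    also have "\<dots> < exp (ln (prob N))" by simp
    finally show False using pos by simp
  qed
  then have "AE \<omega> in M. \<omega> \<notin> N" using N_sets by (simp add: prob_eq_0)
  then show "AE \<omega> in M. \<exists>k\<ge>k0. \<omega> \<notin> oscillates (3 * k) b \<and>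
    c k < \<bar>X (real (3 * k + 1) + 1) \<omega> - X (real (3 * k + 1)) \<omega>\<bar> \<and> \<omega> \<notin> oscillates (3 * k + 2) b"
  proof (rule AE_mp, intro AE_I2 impI)
    fix \<omega> assume "\<omega> \<in> space M" "\<omega> \<notin> N"
    then obtain k where k: "k0 \<le> k" "\<And>m. \<omega> \<in> ?E m k" unfolding N_def by auto
    then show "\<exists>k\<ge>k0. \<omega> \<notin> oscillates (3 * k) b \<and>
      c k < \<bar>X (real (3 * k + 1) + 1) \<omega> - X (real (3 * k + 1)) \<omega>\<bar> \<and> \<omega> \<notin> oscillates (3 * k + 2) b"
      unfolding G0 G1 G2 oscillates_def by blast
  qed
qed

end

context cadlag_levy_process
begin

lemma oscillates_0_tendsto_0: "(\<lambda>k. prob (oscillates 0 (real k))) \<longlonglongrightarrow> 0"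
proof (rule decreasing_events_tendsto_0)
  show "decseq (\<lambda>k. oscillates 0 (real k))"
    unfolding decseq_def oscillates_def oscillates_at_def
    by (auto; meson le_less_trans of_nat_le_iff)
  from cadlag_paths show "AE \<omega> in M. \<exists>k. \<omega> \<notin> oscillates 0 (real k)"
  proof (rule AE_mp, intro AE_I2 impI)
    fix \<omega> assume "cadlag (\<lambda>t. X t \<omega>)"
    from cadlag_bounded[OF this, of 1] obtain B where B: "\<And>t. 0 \<le> t \<Longrightarrow> t \<le> 1 \<Longrightarrow> \<bar>X t \<omega>\<bar> \<le> B"
      by (meson atLeastAtMost_iff)
    obtain k where k: "2 * B \<le> real k" using real_arch_simple by blast
    have "\<bar>X (real i / 2 ^ m) \<omega> - X 0 \<omega>\<bar> \<le> real k" if "i \<le> 2 ^ m" for i m :: nat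
    proof -
      have "real i \<le> 2 ^ m" using that of_nat_le_iff[of i "2 ^ m", where 'a = real] by simp
      then have "real i / 2 ^ m \<le> 1" by simp
      then show ?thesis using B[of "real i / 2 ^ m"] B[of 0] k by simp
    qed
    then show "\<exists>k. \<omega> \<notin> oscillates 0 (real k)"
      by (intro exI[of _ k]) (auto simp: oscillates_def oscillates_at_def not_less)
  qed
qed measurable

text \<open>Only the one-dimensional laws of increments enter the hypothesis and the conclusion of
\<open>ottaviani_inequality\<close>, which makes the bound uniform in \<open>j\<close>. Increments over a time \<open>h \<le> 1\<close> have
the law of \<open>X h - X 0\<close> and are controlled by the oscillation over \<open>[0, 1]\<close>.\<close>

lemma oscillates_bound:
  "\<exists>a0\<ge>0. \<forall>a\<ge>a0. \<forall>j. prob (oscillates j (2 * a)) \<le> 2 * prob {\<omega> \<in> space M. a < \<bar>X 1 \<omega>\<bar>}"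
proof -
  have "\<forall>\<^sub>F k in sequentially. prob (oscillates 0 (real k)) < 1 / 2"
    using oscillates_0_tendsto_0 by (rule order_tendstoD) simp
  then obtain k where k: "prob (oscillates 0 (real k)) < 1 / 2"
    by (auto simp: eventually_sequentially)
  have "prob (oscillates j (2 * a)) \<le> 2 * prob {\<omega> \<in> space M. a < \<bar>X 1 \<omega>\<bar>}" if a: "real k \<le> a" for a j
  proof -
    have level: "prob (oscillates_at m j (2 * a)) \<le> 2 * prob {\<omega> \<in> space M. a < \<bar>X 1 \<omega>\<bar>}" for m
    proof -
      let ?D = "\<lambda>l \<omega>. X (real j + real (Suc l) / 2 ^ m) \<omega> - X (real j + real l / 2 ^ m) \<omega>"
      have S: "(\<Sum>l<i. ?D l \<omega>) = X (real j + real i / 2 ^ m) \<omega> - X (real j) \<omega>" for i \<omega>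
        using grid_telescope[of 0 i "real j" m \<omega>] by (simp add: atLeast0LessThan)
      have R: "(\<Sum>l\<in>{i..<2 ^ m}. ?D l \<omega>) = X (real j + 1) \<omega> - X (real j + real i / 2 ^ m) \<omega>"
        if "i \<le> 2 ^ m" for i \<omega>
        using grid_telescope[OF that, of "real j" m \<omega>] by simp
      have "prob {\<omega> \<in> space M. \<exists>i\<le>2 ^ m. 2 * a < \<bar>\<Sum>l<i. ?D l \<omega>\<bar>} \<le>
          2 * prob {\<omega> \<in> space M. a < \<bar>\<Sum>l<2 ^ m. ?D l \<omega>\<bar>}"
      proof (rule ottaviani_inequality)
        show "indep_vars (\<lambda>_. borel) ?D {..<2 ^ m}" by (rule grid_increments_independent) simp
      next
        fix i :: nat assume i: "i \<le> 2 ^ m"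
        \<comment> \<open>By stationarity the increment from the \<open>i\<close>-th grid point to \<open>j + 1\<close> can be moved to start at 0.\<close>
        define i' where "i' = 2 ^ m - i"
        have i': "i' \<le> 2 ^ m" "real i + real i' = 2 ^ m"
          using i by (auto simp: i'_def of_nat_diff)
        have h: "real j + 1 = real j + real i / 2 ^ m + real i' / 2 ^ m"
          using i'(2) by (simp add: add.assoc add_divide_distrib[symmetric])
        have "prob {\<omega> \<in> space M. a < \<bar>\<Sum>l\<in>{i..<2 ^ m}. ?D l \<omega>\<bar>} =
            prob {\<omega> \<in> space M. a < \<bar>X (real i' / 2 ^ m) \<omega> - X 0 \<omega>\<bar>}"
          unfolding R[OF i] h by (rule prob_increment) auto
        also have "\<dots> \<le> prob (oscillates 0 (real k))"
        proof (rule finite_measure_mono)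
          show "{\<omega> \<in> space M. a < \<bar>X (real i' / 2 ^ m) \<omega> - X 0 \<omega>\<bar>} \<subseteq> oscillates 0 (real k)"
            unfolding oscillates_def oscillates_at_def using i'(1) a
            by (auto intro!: exI[of _ m] exI[of _ i'])
        qed simp
        finally show "prob {\<omega> \<in> space M. a < \<bar>\<Sum>l\<in>{i..<2 ^ m}. ?D l \<omega>\<bar>} \<le> 1 / 2" using k by simp
      qed
      then show ?thesis unfolding S by (simp add: oscillates_at_def prob_unit_increment)
    qed
    have "(\<lambda>m. prob (oscillates_at m j (2 * a))) \<longlonglongrightarrow> prob (\<Union>m. oscillates_at m j (2 * a))"
      using incseq_oscillates_at by (intro finite_Lim_measure_incseq) auto
    then show ?thesis using level unfolding oscillates_def by (auto intro: LIMSEQ_le_const2)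
  qed
  then show ?thesis by (intro exI[of _ "real k"]) auto
qed

lemma quiet_intervals:
  assumes "\<omega> \<in> space M" "cadlag (\<lambda>t. X t \<omega>)" "\<omega> \<notin> oscillates j b" "real j \<le> t" "t \<le> real j + 1"
  shows "\<bar>X t \<omega> - X (real j) \<omega>\<bar> \<le> b"
proof (rule cadlag_dyadic_bound[OF assms(2)])
  fix m i :: nat assume "i \<le> 2 ^ m"
  then show "\<bar>X (real j + real i / 2 ^ m) \<omega> - X (real j) \<omega>\<bar> \<le> b"
    using assms(1,3) by (force simp: oscillates_def oscillates_at_def)
qed (use assms in auto)

section \<open>Paths of a Levy process with a finite moment\<close>

lemma AE_tempered_paths:
  assumes \<eta>: "0 < \<eta>" and fin: "(\<integral>\<^sup>+ \<omega>. ennreal (\<bar>X 1 \<omega>\<bar> powr \<eta>) \<partial>M) < \<infinity>"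
  shows "AE \<omega> in M. \<omega> \<in> tempered_paths M X"
proof -
  have [measurable]: "X 1 \<in> borel_measurable M" by (auto intro: random_variable_X)
  obtain a0 where a0: "\<And>a j. a0 \<le> a \<Longrightarrow>
      prob (oscillates j (2 * a)) \<le> 2 * prob {\<omega> \<in> space M. a < \<bar>X 1 \<omega>\<bar>}"
    using oscillates_bound by blast
  \<comment> \<open>With this \<open>p\<close> the tail of \<open>X 1\<close> at \<open>j ^ p\<close> is at most of order \<open>1 / j ^ 2\<close>, which is summable.\<close>
  obtain p :: nat where p: "2 \<le> real p * \<eta>" "1 \<le> p"
  proof -
    obtain q :: nat where "2 / \<eta> \<le> real q" using real_arch_simple by blast
    then have "2 \<le> real (Suc q) * \<eta>" using \<eta> by (simp add: field_simps)
    then show thesis using that[of "Suc q"] by simp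
  qed
  define e where "e = expectation (\<lambda>\<omega>. \<bar>X 1 \<omega>\<bar> powr \<eta>)"
  have int: "integrable M (\<lambda>\<omega>. \<bar>X 1 \<omega>\<bar> powr \<eta>)"
    using fin by (intro integrableI_bounded) auto
  have tail: "prob {\<omega> \<in> space M. real j ^ p < \<bar>X 1 \<omega>\<bar>} \<le> e / real j ^ 2" if j: "1 \<le> j" for j
  proof -
    have "real j ^ 2 \<le> x powr \<eta>" if x: "real j ^ p < x" for x
    proof -
      have "real j ^ 2 = real j powr 2" using j by simp
      also have "\<dots> \<le> real j powr (real p * \<eta>)" using j p by (intro powr_mono) auto
      also have "\<dots> = (real j ^ p) powr \<eta>" using j by (simp add: powr_powr[symmetric] powr_realpow)
      also have "\<dots> \<le> x powr \<eta>" using x \<eta> by (intro powr_mono2) auto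
      finally show ?thesis .
    qed
    then have "prob {\<omega> \<in> space M. real j ^ p < \<bar>X 1 \<omega>\<bar>} \<le> prob {\<omega> \<in> space M. real j ^ 2 \<le> \<bar>X 1 \<omega>\<bar> powr \<eta>}"
      by (intro finite_measure_mono) auto
    also have "\<dots> \<le> e / real j ^ 2"
      unfolding e_def using j by (intro integral_Markov_inequality_measure[OF int, where A = "{}"]) auto
    finally show ?thesis .
  qed
  have summ: "summable (\<lambda>j. prob (oscillates j (2 * real j ^ p)))"
  proof (rule summable_comparison_test_ev)
    show "summable (\<lambda>j. 2 * (e * inverse (real j ^ 2)))"
      using inverse_power_summable[of 2, where 'a = real] by (intro summable_mult) auto
    obtain J :: nat where J: "a0 \<le> real J" using real_arch_simple by blast
    show "\<forall>\<^sub>F j in sequentially. norm (prob (oscillates j (2 * real j ^ p))) \<le> 2 * (e * inverse (real j ^ 2))"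
      using eventually_ge_at_top[of "max 1 J"]
    proof eventually_elim
      case (elim j)
      have "real j \<le> real j ^ p" using elim p by (intro self_le_power) auto
      then have "a0 \<le> real j ^ p" using J elim by linarith
      from a0[OF this, of j] tail[of j] elim show ?case by (simp add: divide_inverse)
    qed
  qed
  have "AE \<omega> in M. \<forall>\<^sub>F j in sequentially. \<omega> \<in> space M - oscillates j (2 * real j ^ p)"
    using summ by (intro borel_cantelli_AE1) (auto simp: emeasure_eq_measure)
  with cadlag_paths show ?thesis
  proof (eventually_elim)
    case (elim \<omega>)
    then obtain J where J: "\<And>j. J \<le> j \<Longrightarrow> \<omega> \<in> space M - oscillates j (2 * real j ^ p)"
      by (auto simp: eventually_sequentially)
    have \<omega>: "\<omega> \<in> space M" using J[of J] by simp
    obtain C N where "\<forall>t\<ge>0. \<bar>X t \<omega>\<bar> \<le> C * (1 + t ^ N)"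
      using polynomial_growth_of_increments[OF elim(1), of J p] quiet_intervals[OF \<omega> elim(1)] J by blast
    then show ?case
      using path_functional_tempered[of X \<omega> C N] cadlag_measurable[OF elim(1)] \<omega>
      by (simp add: tempered_paths_def)
  qed
qed

section \<open>Paths of a Levy process without finite moments\<close>

text \<open>With \<open>Y = \<bar>X 1\<bar> powr (1 / N)\<close>, the terms are the probabilities that \<open>Y > k + 1\<close>, and their sum is at
least the expectation of \<open>Y\<close> minus 1.\<close>

lemma not_summable_tail:
  assumes N: "1 \<le> N" and inf: "\<And>\<eta>. 0 < \<eta> \<Longrightarrow> (\<integral>\<^sup>+ \<omega>. ennreal (\<bar>X 1 \<omega>\<bar> powr \<eta>) \<partial>M) = \<infinity>"
  shows "\<not> summable (\<lambda>k. prob {\<omega> \<in> space M. (real k + 1) ^ N < \<bar>X 1 \<omega>\<bar>})"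
proof
  assume s: "summable (\<lambda>k. prob {\<omega> \<in> space M. (real k + 1) ^ N < \<bar>X 1 \<omega>\<bar>})"
  have [measurable]: "X 1 \<in> borel_measurable M" by (auto intro: random_variable_X)
  let ?A = "\<lambda>k. {\<omega> \<in> space M. (real k + 1) ^ N < \<bar>X 1 \<omega>\<bar>}"
  have le: "ennreal (\<bar>X 1 \<omega>\<bar> powr (1 / real N)) \<le> 1 + (\<Sum>k. indicator (?A k) \<omega>)" if \<omega>: "\<omega> \<in> space M" for \<omega>
  proof -
    define y where "y = \<bar>X 1 \<omega>\<bar> powr (1 / real N)"
    define n where "n = nat (\<lceil>y\<rceil> - 1)"
    have "(real k + 1) ^ N < \<bar>X 1 \<omega>\<bar>" if "k < n" for k
    proof -
      have "real k + 1 < y" using that unfolding n_def by linarith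
      then have "(real k + 1) powr real N < y powr real N" using N by (intro powr_less_mono2) auto
      also have "y powr real N = \<bar>X 1 \<omega>\<bar>" using N by (simp add: y_def powr_powr)
      finally show ?thesis by (simp add: powr_realpow)
    qed
    then have "(\<Sum>k<n. indicator (?A k) \<omega> :: ennreal) = of_nat n" using \<omega> by simp
    moreover have "(\<Sum>k<n. indicator (?A k) \<omega> :: ennreal) \<le> (\<Sum>k. indicator (?A k) \<omega>)"
      by (intro sum_le_suminf) auto
    ultimately have "1 + of_nat n \<le> 1 + (\<Sum>k. indicator (?A k) \<omega> :: ennreal)" by (simp add: add_left_mono)
    moreover have "ennreal y \<le> 1 + of_nat n"
    proof -
      have "y \<le> 1 + real n" unfolding n_def by linarith
      then have "ennreal y \<le> ennreal (1 + real n)" by (rule ennreal_leI)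
      also have "\<dots> = 1 + of_nat n" by (simp add: ennreal_plus ennreal_of_nat_eq_real_of_nat)
      finally show ?thesis .
    qed
    ultimately show ?thesis unfolding y_def by (rule order_trans[rotated])
  qed
  have "(\<integral>\<^sup>+ \<omega>. ennreal (\<bar>X 1 \<omega>\<bar> powr (1 / real N)) \<partial>M) \<le> (\<integral>\<^sup>+ \<omega>. 1 + (\<Sum>k. indicator (?A k) \<omega>) \<partial>M)"
    by (intro nn_integral_mono le)
  also have "\<dots> = 1 + (\<Sum>k. emeasure M (?A k))"
    by (subst nn_integral_add) (auto simp: nn_integral_suminf emeasure_space_1)
  also have "\<dots> = 1 + ennreal (\<Sum>k. prob (?A k))"
    using s by (simp add: emeasure_eq_measure suminf_ennreal2)
  also have "\<dots> < \<infinity>" by simp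
  finally show False using inf[of "1 / real N"] N by simp
qed

lemma AE_not_tempered_paths:
  assumes inf: "\<And>\<eta>. 0 < \<eta> \<Longrightarrow> (\<integral>\<^sup>+ \<omega>. ennreal (\<bar>X 1 \<omega>\<bar> powr \<eta>) \<partial>M) = \<infinity>"
  shows "AE \<omega> in M. \<omega> \<notin> tempered_paths M X"
proof -
  have rv: "X 1 \<in> borel_measurable M" by (auto intro: random_variable_X)
  obtain a0 where a0: "0 \<le> a0" "\<And>a j. a0 \<le> a \<Longrightarrow>
      prob (oscillates j (2 * a)) \<le> 2 * prob {\<omega> \<in> space M. a < \<bar>X 1 \<omega>\<bar>}"
    using oscillates_bound by blast
  have "\<forall>\<^sub>F k in sequentially. prob {\<omega> \<in> space M. real k < \<bar>X 1 \<omega>\<bar>} < 1 / 4"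
    using tail_prob_tendsto_0[OF rv] by (rule order_tendstoD) simp
  then obtain k1 where k1: "\<And>k. k1 \<le> k \<Longrightarrow> prob {\<omega> \<in> space M. real k < \<bar>X 1 \<omega>\<bar>} < 1 / 4"
    by (auto simp: eventually_sequentially)
  obtain k2 :: nat where k2: "a0 \<le> real k2" using real_arch_simple by blast
  define b where "b = 2 * real (max k1 k2)"
  have b0: "0 \<le> b" by (simp add: b_def)
  have quiet: "prob (oscillates j b) \<le> 1 / 2" for j
    using a0(2)[of "real (max k1 k2)" j] k1[of "max k1 k2"] k2 unfolding b_def by linarith
  have "AE \<omega> in M. \<forall>N k0. \<exists>k\<ge>k0. \<omega> \<notin> oscillates (3 * k) b \<and>
      (real k + 1) ^ Suc N < \<bar>X (real (3 * k + 1) + 1) \<omega> - X (real (3 * k + 1)) \<omega>\<bar> \<and>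
      \<omega> \<notin> oscillates (3 * k + 2) b"
    unfolding AE_all_countable[of "\<lambda>N \<omega>. \<forall>k0. _ N k0 \<omega>"]
    by (intro allI quiet_jump_quiet_infinitely_often quiet not_summable_tail inf) auto
  with cadlag_paths AE_space show ?thesis
  proof eventually_elim
    case (elim \<omega>)
    show ?case
    proof
      assume "\<omega> \<in> tempered_paths M X"
      from tempered_path_growth[OF this] obtain C N where C: "0 \<le> C" and
        growth: "\<And>n b. (\<And>t. real n \<le> t \<Longrightarrow> t \<le> real n + 1 \<Longrightarrow> \<bar>X t \<omega> - X (real n) \<omega>\<bar> \<le> b) \<Longrightarrow>
          \<bar>X (real n) \<omega>\<bar> \<le> C * (real n + 1) ^ N + b" by blast
      have growth': "\<bar>X (real n) \<omega>\<bar> \<le> C * 3 ^ N * (real k + 1) ^ N + b"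
        if "\<omega> \<notin> oscillates n b" "n \<le> 3 * k + 2" for n k
      proof -
        have "\<bar>X (real n) \<omega>\<bar> \<le> C * (real n + 1) ^ N + b"
          by (intro growth quiet_intervals[OF elim(2,1) that(1)])
        also have "C * (real n + 1) ^ N \<le> C * (3 * (real k + 1)) ^ N"
          using that(2) C by (intro mult_left_mono power_mono) auto
        finally show ?thesis using C by (simp only: power_mult_distrib mult_left_mono mult.assoc)
      qed
      \<comment> \<open>The increment over the middle interval is bounded by \<open>D * (k + 1) ^ N\<close>: two polynomial bounds
          for the ends, and three times \<open>b\<close>: once for each end and once for crossing the first interval.\<close>
      define D where "D = 2 * (C * 3 ^ N) + 3 * b"
      obtain k0 :: nat where k0: "D \<le> real k0" using real_arch_simple by blast
      obtain k where k: "k0 \<le> k" "\<omega> \<notin> oscillates (3 * k) b" "\<omega> \<notin> oscillates (3 * k + 2) b"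
        "(real k + 1) ^ Suc N < \<bar>X (real (3 * k + 1) + 1) \<omega> - X (real (3 * k + 1)) \<omega>\<bar>"
        using elim(3) by blast
      have "\<bar>X (real (3 * k) + 1) \<omega> - X (real (3 * k)) \<omega>\<bar> \<le> b"
        by (rule quiet_intervals[OF elim(2,1) k(2)]) auto
      moreover have "\<bar>X (real (3 * k)) \<omega>\<bar> \<le> C * 3 ^ N * (real k + 1) ^ N + b"
        by (rule growth') (use k in auto)
      moreover have "\<bar>X (real (3 * k + 2)) \<omega>\<bar> \<le> C * 3 ^ N * (real k + 1) ^ N + b"
        by (rule growth') (use k in auto)
      moreover have "real (3 * k + 1) + 1 = real (3 * k + 2)" "real (3 * k + 1) = real (3 * k) + 1" by auto
      ultimately have "(real k + 1) ^ Suc N < 2 * (C * 3 ^ N * (real k + 1) ^ N) + 3 * b"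
        using k(4) by (simp only:)
      also have "\<dots> \<le> D * (real k + 1) ^ N"
        using mult_left_mono[of 1 "(real k + 1) ^ N" "3 * b"] b0 by (simp add: D_def distrib_right)
      also have "\<dots> \<le> (real k + 1) * (real k + 1) ^ N"
        using k0 k(1) by (intro mult_right_mono) auto
      finally show False by simp
    qed
  qed
qed

end

theorem corollary2p6:
  fixes M :: "'w measure" and X :: "real \<Rightarrow> 'w \<Rightarrow> real"
    and \<gamma> \<sigma> :: real and \<nu> :: "real measure"
  assumes "complete_measure M"
    and "cadlag_levy_process M X"
    and "characteristic_triplet M X \<gamma> \<sigma> \<nu>"
  shows "((\<exists>\<eta>::real>0. (\<integral>\<^sup>+ \<omega>. ennreal (\<bar>X 1 \<omega>\<bar> powr \<eta>) \<partial>M) < \<infinity>) \<longrightarrow>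
           tempered_paths M X \<in> sets M \<and> measure M (tempered_paths M X) = 1) \<and>
         ((\<forall>\<eta>::real>0. (\<integral>\<^sup>+ \<omega>. ennreal (\<bar>X 1 \<omega>\<bar> powr \<eta>) \<partial>M) = \<infinity>) \<longrightarrow>
           tempered_paths M X \<in> sets M \<and> measure M (tempered_paths M X) = 0)"
proof -
  interpret complete_measure M by fact
  interpret cadlag_levy_process M X by fact
  have sub: "tempered_paths M X \<subseteq> space M" by (auto simp: tempered_paths_def)
  show ?thesis
  proof (intro conjI impI)
    assume "\<exists>\<eta>::real>0. (\<integral>\<^sup>+ \<omega>. ennreal (\<bar>X 1 \<omega>\<bar> powr \<eta>) \<partial>M) < \<infinity>"
    then have AE: "AE \<omega> in M. \<omega> \<in> tempered_paths M X" using AE_tempered_paths by blast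
    then obtain N where N: "N \<in> null_sets M" "space M - tempered_paths M X \<subseteq> N"
      by (auto simp: eventually_ae_filter Diff_eq)
    have "space M - (space M - tempered_paths M X) \<in> sets M"
      by (intro sets.Diff sets.top complete[OF N(2,1)])
    then show "tempered_paths M X \<in> sets M" using sub by (simp add: double_diff)
    then show "measure M (tempered_paths M X) = 1" using AE by (simp add: prob_eq_1)
  next
    assume "\<forall>\<eta>::real>0. (\<integral>\<^sup>+ \<omega>. ennreal (\<bar>X 1 \<omega>\<bar> powr \<eta>) \<partial>M) = \<infinity>"
    then have AE: "AE \<omega> in M. \<omega> \<notin> tempered_paths M X" using AE_not_tempered_paths by blast
    then obtain N where N: "N \<in> null_sets M" "tempered_paths M X \<subseteq> N"
      using sub by (auto simp: eventually_ae_filter)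
    show "tempered_paths M X \<in> sets M" by (rule complete[OF N(2,1)])
    then show "measure M (tempered_paths M X) = 0" using AE by (simp add: prob_eq_0)
  qed
qed

end
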